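(* Let $p$ be a prime number and let $A,B$ be finitely generated residually $p$-finite $p$-IAS groups. Then $A\times B$ is $p$-IAS and, consequently, $\operatorname{Out}_p(A\times B)$ is residually $p$-finite and $\operatorname{Out}(A\times B)$ is virtually residually $p$-finite.
   Context: A group $G$ is residually $p$-finite if for every $g \in G\setminus\{1\}$ there is $N \unlhd G$ with $G/N$ a finite $p$-group and $g\notin N$. A group is virtually residually $p$-finite if it has a finite-index subgroup that is residually $p$-finite. A group $G$ is $p$-inner automorphism separable ($p$-IAS) if for every $\phi \in \operatorname{Aut}(G)\setminus\operatorname{Inn}(G)$ there is a characteristic subgroup $K$ of $G$ with $G/K$ a finite $p$-group such that $\tilde{\kappa}(\phi)\notin \operatorname{Inn}(G/K)$, where $\tilde{\kappa}\colon\operatorname{Aut}(G)\to\operatorname{Aut}(G/K)$ is given by $\tilde{\kappa}(\psi)(gK) = \psi(g)K$. For a group $G$, let $K_p = [G,G]G_p$, where $G_p$ is the subgroup generated by all $g^p$, $g \in G$. Then $\operatorname{Aut}_p(G)$ is the kernel of the natural homomorphism $\operatorname{Aut}(G)\to\operatorname{Aut}(G/K_p)$; it contains $\operatorname{Inn}(G)$, and $\operatorname{Out}_p(G) = \operatorname{Aut}_p(G)/\operatorname{Inn}(G) \leq \operatorname{Out}(G)= \operatorname{Aut}(G)/\operatorname{Inn}(G)$. *)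

theory Defs
  imports "HOL-Algebra.Bij" "HOL-Algebra.Generated_Groups" "HOL-Computational_Algebra.Primes"
begin

definition finitely_generated :: "('a, 'b) monoid_scheme \<Rightarrow> bool" where
  "finitely_generated G \<longleftrightarrow> (\<exists>S \<subseteq> carrier G. finite S \<and> generate G S = carrier G)"

text \<open>The trivial group counts as a finite \<open>p\<close>-group (\<open>n = 0\<close>).\<close>

definition finite_p_group :: "nat \<Rightarrow> ('a, 'b) monoid_scheme \<Rightarrow> bool" where
  "finite_p_group p G \<longleftrightarrow> group G \<and> finite (carrier G) \<and> (\<exists>n. order G = p ^ n)"

definition residually_p_finite :: "nat \<Rightarrow> ('a, 'b) monoid_scheme \<Rightarrow> bool" where
  "residually_p_finite p G \<longleftrightarrow> group G \<and>
     (\<forall>g \<in> carrier G - {\<one>\<^bsub>G\<^esub>}. \<exists>N. N \<lhd> G \<and> finite_p_group p (G Mod N) \<and> g \<notin> N)"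

definition virtually_residually_p_finite :: "nat \<Rightarrow> ('a, 'b) monoid_scheme \<Rightarrow> bool" where
  "virtually_residually_p_finite p G \<longleftrightarrow> group G \<and>
     (\<exists>H. subgroup H G \<and> finite (rcosets\<^bsub>G\<^esub> H) \<and> residually_p_finite p (G\<lparr>carrier := H\<rparr>))"

text \<open>The restriction makes inner automorphisms extensional, as all elements of
  \<^const>\<open>auto\<close> are.\<close>

definition inn :: "('a, 'b) monoid_scheme \<Rightarrow> ('a \<Rightarrow> 'a) set" where
  "inn G = (\<lambda>g. \<lambda>x \<in> carrier G. g \<otimes>\<^bsub>G\<^esub> x \<otimes>\<^bsub>G\<^esub> inv\<^bsub>G\<^esub> g) ` carrier G"

definition characteristic :: "'a set \<Rightarrow> ('a, 'b) monoid_scheme \<Rightarrow> bool" where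
  "characteristic K G \<longleftrightarrow> subgroup K G \<and> (\<forall>\<phi> \<in> auto G. \<phi> ` K = K)"

text \<open>For characteristic \<open>K\<close>, an automorphism \<open>\<psi>\<close> maps the coset of \<open>g\<close> as a set onto the coset
  of \<open>\<psi> g\<close>, so taking images of cosets is the induced automorphism of the quotient; see
  \<open>induced_auto_coset\<close> below.\<close>

definition induced_auto ::
  "('a, 'b) monoid_scheme \<Rightarrow> 'a set \<Rightarrow> ('a \<Rightarrow> 'a) \<Rightarrow> 'a set \<Rightarrow> 'a set" where
  "induced_auto G K \<psi> = (\<lambda>C \<in> carrier (G Mod K). \<psi> ` C)"

definition p_IAS :: "nat \<Rightarrow> ('a, 'b) monoid_scheme \<Rightarrow> bool" where
  "p_IAS p G \<longleftrightarrow> group G \<and>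
     (\<forall>\<phi> \<in> auto G - inn G. \<exists>K. characteristic K G \<and> finite_p_group p (G Mod K) \<and>
        induced_auto G K \<phi> \<notin> inn (G Mod K))"

definition K_p :: "nat \<Rightarrow> ('a, 'b) monoid_scheme \<Rightarrow> 'a set" where
  "K_p p G = derived G (carrier G) <#>\<^bsub>G\<^esub> generate G ((\<lambda>g. g [^]\<^bsub>G\<^esub> p) ` carrier G)"

definition Aut_p :: "nat \<Rightarrow> ('a, 'b) monoid_scheme \<Rightarrow> ('a \<Rightarrow> 'a) set" where
  "Aut_p p G =
     kernel (AutoGroup G) (AutoGroup (G Mod K_p p G)) (induced_auto G (K_p p G))"

definition Out :: "('a, 'b) monoid_scheme \<Rightarrow> ('a \<Rightarrow> 'a) set monoid" where
  "Out G = AutoGroup G Mod inn G"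

definition Out_p :: "nat \<Rightarrow> ('a, 'b) monoid_scheme \<Rightarrow> ('a \<Rightarrow> 'a) set monoid" where
  "Out_p p G = (AutoGroup G)\<lparr>carrier := Aut_p p G\<rparr> Mod inn G"

lemma induced_auto_coset:
  assumes "group G" "characteristic K G" "\<psi> \<in> auto G" "g \<in> carrier G"
  shows "induced_auto G K \<psi> (K #>\<^bsub>G\<^esub> g) = K #>\<^bsub>G\<^esub> \<psi> g"
proof -
  have sub: "K \<subseteq> carrier G" and img: "\<psi> ` K = K"
    using assms by (auto simp: characteristic_def dest: subgroup.subset)
  have "\<psi> (k \<otimes>\<^bsub>G\<^esub> g) = \<psi> k \<otimes>\<^bsub>G\<^esub> \<psi> g" if "k \<in> K" for k
    using that sub assms by (auto simp: auto_def hom_def)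
  then have "\<psi> ` (K #>\<^bsub>G\<^esub> g) = (\<Union>k\<in>K. {\<psi> k \<otimes>\<^bsub>G\<^esub> \<psi> g})"
    by (simp add: r_coset_def image_UN)
  also have "\<dots> = (\<Union>k\<in>\<psi> ` K. {k \<otimes>\<^bsub>G\<^esub> \<psi> g})"
    by simp
  also have "\<dots> = K #>\<^bsub>G\<^esub> \<psi> g"
    by (simp add: img r_coset_def)
  finally show ?thesis
    using assms by (auto simp: induced_auto_def FactGroup_def RCOSETS_def)
qed

end

theory Submission
  imports Defs "HOL-Algebra.Group_Action" "HOL-Algebra.Sylow" "HOL-Algebra.Multiplicative_Group"
    "HOL-Algebra.SndIsomorphismGrp"
begin

text \<open>Let \<open>\<phi>\<close> be an automorphism of \<open>G = A \<times> B\<close> that becomes inner in every characteristic finite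
  \<open>p\<close>-quotient. As \<open>G\<close> is finitely generated, the kernel of any homomorphism \<open>f\<close> from \<open>G\<close> to a finite
  \<open>p\<close>-group contains a characteristic subgroup of \<open>p\<close>-power index, so \<open>f \<circ> \<phi>\<close> and \<open>f\<close> differ by a
  conjugation. Letting \<open>f\<close> run through the finite \<open>p\<close>-quotients of \<open>B\<close>, residual \<open>p\<close>-finiteness gives
  \<open>\<phi>(A) \<subseteq> A\<close>, and symmetrically \<open>\<phi>(B) \<subseteq> B\<close>, so \<open>\<phi> = \<alpha> \<times> \<beta>\<close>. Letting \<open>f\<close> run through the characteristic
  finite \<open>p\<close>-quotients of \<open>A\<close> and \<open>B\<close>, the \<open>p\<close>-IAS property shows that \<open>\<alpha>\<close> and \<open>\<beta>\<close> are inner.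

  For a \<open>p\<close>-IAS group \<open>G\<close>, the homomorphisms \<open>Out\<^sub>p(G) \<rightarrow> Out\<^sub>p(G/K)\<close> with \<open>G/K\<close> a characteristic finite
  \<open>p\<close>-quotient separate the elements of \<open>Out\<^sub>p(G)\<close>, and their targets are \<open>p\<close>-groups by P. Hall's
  theorem. If \<open>G\<close> is finitely generated then \<open>G/K\<^sub>p\<close> is finite, hence \<open>Out\<^sub>p(G)\<close> has finite index.\<close>

subsection \<open>Finite \<open>p\<close>-groups\<close>

lemma finite_p_group_subgroup:
  assumes "Factorial_Ring.prime p" "finite_p_group p G" "subgroup H G"
  shows "finite_p_group p (G\<lparr>carrier := H\<rparr>)"
proof -
  interpret group G using assms by (simp add: finite_p_group_def)
  obtain n where n: "order G = p ^ n" using assms by (auto simp: finite_p_group_def)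
  have "card H dvd p ^ n" using lagrange[OF assms(3)] n by (metis dvd_triv_right)
  then have "\<exists>k. card H = p ^ k" using divides_primepow_nat[OF assms(1)] by blast
  moreover have "finite H"
    using assms finite_subset[OF subgroup.subset[OF assms(3)]] by (simp add: finite_p_group_def)
  ultimately show ?thesis
    using subgroup_imp_group[OF assms(3)] by (simp add: finite_p_group_def order_def)
qed

lemma finite_p_group_iso:
  assumes "G \<cong> H" "finite_p_group p H" "group G"
  shows "finite_p_group p G"
  using assms iso_same_card[OF assms(1)] iso_finite[OF assms(1)]
  by (simp add: finite_p_group_def order_def)

lemma finite_p_group_Mod_kernel:
  assumes "Factorial_Ring.prime p" "group G" "finite_p_group p P" "f \<in> hom G P"
  shows "finite_p_group p (G Mod kernel G P f)"
proof -
  interpret P: group P using assms by (simp add: finite_p_group_def)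
  interpret f: group_hom G P f
    using assms by (simp add: group_hom_def group_hom_axioms_def P.group_axioms)
  \<comment> \<open>The codomain is cut down to the image because \<open>FactGroup_iso\<close> wants
    a surjective map; the kernel stays the same. The image is a subgroup of
    \<open>P\<close>.\<close>
  let ?I = "P\<lparr>carrier := f ` carrier G\<rparr>"
  have I: "finite_p_group p ?I"
    by (rule finite_p_group_subgroup[OF assms(1,3) f.img_is_subgroup])
  interpret g: group_hom G ?I f
    using I f.G.group_axioms
    by (auto simp: group_hom_def group_hom_axioms_def finite_p_group_def hom_def)
  have "G Mod kernel G ?I f \<cong> ?I" by (rule g.FactGroup_iso) simp
  moreover have "kernel G ?I f = kernel G P f" by (simp add: kernel_def)
  moreover have "group (G Mod kernel G P f)"
    using f.normal_kernel normal.factorgroup_is_group by blast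
  ultimately show ?thesis using finite_p_group_iso[OF _ I] by simp
qed

lemma finite_p_group_Mod:
  assumes "Factorial_Ring.prime p" "finite_p_group p G" "N \<lhd> G"
  shows "finite_p_group p (G Mod N)"
proof -
  interpret normal N G by fact
  obtain n where n: "order G = p ^ n" and fin: "finite (carrier G)"
    using assms by (auto simp: finite_p_group_def)
  have "order (G Mod N) dvd p ^ n"
    using lagrange[OF subgroup_axioms] n by (simp add: order_def FactGroup_def) (metis dvd_triv_left)
  then have "\<exists>k. order (G Mod N) = p ^ k" using divides_primepow_nat[OF assms(1)] by blast
  moreover have "finite (carrier (G Mod N))" using fin by (simp add: carrier_FactGroup)
  ultimately show ?thesis using factorgroup_is_group by (simp add: finite_p_group_def)
qed

section \<open>Orbit counting and maximal subgroups of finite p-groups\<close>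

text \<open>Orbit sizes divide \<open>p ^ n\<close>, so every orbit with more than one point has
  size divisible by \<open>p\<close>. If \<open>x\<^sub>0\<close> were the only fixed point,
  \<open>card E\<close> would be 1 modulo \<open>p\<close>.\<close>

lemma (in group_action) second_fixed_point:
  assumes "Factorial_Ring.prime p" "order G = p ^ n" "finite E" "p dvd card E"
    and "x\<^sub>0 \<in> E" "\<forall>g \<in> carrier G. \<phi> g x\<^sub>0 = x\<^sub>0"
  shows "\<exists>x \<in> E. x \<noteq> x\<^sub>0 \<and> (\<forall>g \<in> carrier G. \<phi> g x = x)"
proof (rule ccontr)
  assume no: "\<not> ?thesis"
  interpret group G using group_hom by (simp add: group_hom_def)
  let ?O = "orbits G E \<phi>"
  have O0: "orbit G \<phi> x\<^sub>0 = {x\<^sub>0}"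
    using assms(6) by (auto simp: orbit_def intro!: exI[of _ \<one>])
  have "p dvd card O'" if O': "O' \<in> ?O - {{x\<^sub>0}}" for O'
  proof -
    obtain x where x: "x \<in> E" "O' = orbit G \<phi> x" using O' by (auto simp: orbits_def)
    have "card O' dvd p ^ n"
      using orbit_stabilizer_theorem[OF x(1)] x(2) assms(2) by (metis dvd_triv_left)
    then obtain k where k: "card O' = p ^ k" using divides_primepow_nat[OF assms(1)] by blast
    have "k \<noteq> 0"
    proof
      assume "k = 0"
      then obtain y where "O' = {y}" using k card_1_singletonE by auto
      then have "O' = {x}" using orbit_refl[OF x(1)] x(2) by auto
      then have "\<forall>g \<in> carrier G. \<phi> g x = x" using x(2) by (auto simp: orbit_def)
      then have "x = x\<^sub>0" using no x(1) by blast
      then show False using O' \<open>O' = {x}\<close> by simp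
    qed
    then show ?thesis using k by simp
  qed
  moreover have fO: "finite ?O" using assms(3) by (simp add: orbits_def)
  moreover have "card E = (\<Sum>O' \<in> ?O. card O')"
    using disjoint_sum[OF assms(3), of "\<lambda>_. 1::nat"] by simp
  moreover have "{x\<^sub>0} \<in> ?O" using O0 assms(5) by (auto simp: orbits_def)
  ultimately have "card E = 1 + (\<Sum>O' \<in> ?O - {{x\<^sub>0}}. card O')"
    and "p dvd (\<Sum>O' \<in> ?O - {{x\<^sub>0}}. card O')"
    by (auto simp: sum.remove[of ?O "{x\<^sub>0}"] intro: dvd_sum)
  then have "p dvd 1" using assms(4) by (simp only: dvd_add_left_iff)
  then show False using assms(1) by simp
qed

text \<open>\<open>group_action\<close> asks for a homomorphism into \<open>BijGroup E\<close>.
  Bijectivity of each map follows from the pointwise laws, the inverse element acting as the inverse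
  map; \<open>ext\<close> is required because \<open>Bij\<close> contains only extensional
  functions.\<close>

lemma group_actionI:
  assumes "group G"
    and closed: "\<And>g x. \<lbrakk>g \<in> carrier G; x \<in> E\<rbrakk> \<Longrightarrow> \<phi> g x \<in> E"
    and mult: "\<And>g h x. \<lbrakk>g \<in> carrier G; h \<in> carrier G; x \<in> E\<rbrakk> \<Longrightarrow> \<phi> (g \<otimes>\<^bsub>G\<^esub> h) x = \<phi> g (\<phi> h x)"
    and one: "\<And>x. x \<in> E \<Longrightarrow> \<phi> \<one>\<^bsub>G\<^esub> x = x"
    and ext: "\<And>g. g \<in> carrier G \<Longrightarrow> \<phi> g \<in> extensional E"
  shows "group_action G E \<phi>"
proof -
  interpret group G by fact
  have inv: "\<phi> (inv\<^bsub>G\<^esub> g) (\<phi> g x) = x" "\<phi> g (\<phi> (inv\<^bsub>G\<^esub> g) x) = x"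
    if "g \<in> carrier G" "x \<in> E" for g x
    using that mult[of "inv\<^bsub>G\<^esub> g" g x] mult[of g "inv\<^bsub>G\<^esub> g" x] one by simp_all
  have Bij: "\<phi> g \<in> Bij E" if g: "g \<in> carrier G" for g
  proof -
    have "bij_betw (\<phi> g) E E"
      by (rule bij_betw_byWitness[where f' = "\<phi> (inv\<^bsub>G\<^esub> g)"]) (use g inv closed in auto)
    then show ?thesis using ext[OF g] by (simp add: Bij_def)
  qed
  have "\<phi> \<in> hom G (BijGroup E)"
  proof (rule homI)
    fix g h assume gh: "g \<in> carrier G" "h \<in> carrier G"
    have "\<phi> (g \<otimes>\<^bsub>G\<^esub> h) = compose E (\<phi> g) (\<phi> h)"
      by (rule extensionalityI[of _ E]) (use gh ext mult in \<open>simp_all add: compose_eq\<close>)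
    then show "\<phi> (g \<otimes>\<^bsub>G\<^esub> h) = \<phi> g \<otimes>\<^bsub>BijGroup E\<^esub> \<phi> h"
      using Bij gh by (simp add: BijGroup_def)
  qed (use Bij in \<open>simp add: BijGroup_def\<close>)
  then show ?thesis
    using group_BijGroup by (simp add: group_action_def group_hom_def group_hom_axioms_def)
qed

text \<open>Right multiplication reverses products; the inverse turns it into a left action.\<close>

lemma (in group) coset_action:
  assumes "subgroup M G"
  shows "group_action (G\<lparr>carrier := M\<rparr>) (rcosets M) (\<lambda>m. \<lambda>C \<in> rcosets M. C #> inv m)"
proof -
  have MG: "M \<subseteq> carrier G" using assms subgroup.subset by blast
  have CG: "C \<subseteq> carrier G" if "C \<in> rcosets M" for C
    using that MG rcosets_subset_PowG[OF assms] by auto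
  have cl: "C #> x \<in> rcosets M" if "C \<in> rcosets M" "x \<in> carrier G" for C x
    using that MG by (force simp: RCOSETS_def coset_mult_assoc)
  have "m \<in> carrier G" if "m \<in> M" for m using that MG by auto
  then show ?thesis
    by (intro group_actionI subgroup_imp_group[OF assms])
      (simp_all add: cl CG coset_mult_assoc inv_mult_group)
qed

lemma (in group) card_eq_order_subgroup:
  assumes "finite (carrier G)" "subgroup H G" "card H = order G"
  shows "H = carrier G"
  using assms card_subset_eq[OF assms(1) subgroup.subset[OF assms(2)]] by (simp add: order_def)

text \<open>\<open>M\<close> fixes the coset \<open>M\<close> under right multiplication and \<open>p\<close> divides the number of cosets, so it
  fixes some \<open>M x \<noteq> M\<close>. Then \<open>x\<close> normalizes \<open>M\<close>, and by maximality so does \<open>Q\<close>.\<close>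

lemma maximal_subgroup_p_group_normal:
  assumes "Factorial_Ring.prime p" "finite_p_group p Q"
    and M: "subgroup M Q" "M \<noteq> carrier Q"
    and maximal: "\<And>L. \<lbrakk>subgroup L Q; M \<subset> L\<rbrakk> \<Longrightarrow> L = carrier Q"
  shows "M \<lhd> Q"
proof -
  interpret group Q using assms by (simp add: finite_p_group_def)
  have fin: "finite (carrier Q)" using assms by (simp add: finite_p_group_def)
  have MQ: "M \<subseteq> carrier Q" using M subgroup.subset by blast
  interpret act: group_action "Q\<lparr>carrier := M\<rparr>" "rcosets\<^bsub>Q\<^esub> M" "\<lambda>m. \<lambda>C \<in> rcosets\<^bsub>Q\<^esub> M. C #>\<^bsub>Q\<^esub> inv\<^bsub>Q\<^esub> m"
    by (rule coset_action[OF M(1)])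
  obtain n where n: "order Q = p ^ n" using assms by (auto simp: finite_p_group_def)
  obtain k where k: "order (Q\<lparr>carrier := M\<rparr>) = p ^ k"
    using finite_p_group_subgroup[OF assms(1,2) M(1)] by (auto simp: finite_p_group_def)
  have lag: "card (rcosets\<^bsub>Q\<^esub> M) * card M = p ^ n" using lagrange[OF M(1)] n by simp
  then obtain j where j: "card (rcosets\<^bsub>Q\<^esub> M) = p ^ j"
    using divides_primepow_nat[OF assms(1)] by (metis dvd_triv_left)
  have "j \<noteq> 0"
  proof
    assume "j = 0"
    then have "card M = order Q" using lag j n by simp
    then show False using card_eq_order_subgroup[OF fin M(1)] M(2) by simp
  qed
  then have pd: "p dvd card (rcosets\<^bsub>Q\<^esub> M)" using j by simp
  have M0: "M \<in> rcosets\<^bsub>Q\<^esub> M" using subgroup.subgroup_in_rcosets[OF M(1)] by (simp add: group_axioms)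
  have fixM: "M #>\<^bsub>Q\<^esub> inv\<^bsub>Q\<^esub> m = M" if "m \<in> M" for m
    using that MQ M(1) by (intro coset_join2) (auto dest: subgroup.m_inv_closed)
  obtain C where C: "C \<in> rcosets\<^bsub>Q\<^esub> M" "C \<noteq> M" "\<forall>m \<in> M. C #>\<^bsub>Q\<^esub> inv\<^bsub>Q\<^esub> m = C"
  proof -
    have "finite (rcosets\<^bsub>Q\<^esub> M)" using fin by (simp add: RCOSETS_def)
    then have "\<exists>C \<in> rcosets\<^bsub>Q\<^esub> M. C \<noteq> M \<and> (\<forall>m \<in> M. C #>\<^bsub>Q\<^esub> inv\<^bsub>Q\<^esub> m = C)"
      using act.second_fixed_point[OF assms(1) k _ pd M0] fixM M0 by simp
    then show ?thesis using that by blast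
  qed
  obtain x where x: "x \<in> carrier Q" "C = M #>\<^bsub>Q\<^esub> x" using C by (auto simp: RCOSETS_def)
  have xM: "x \<notin> M" using x C(2) M(1) coset_join2[of x M] by blast
  define c where "c g m = g \<otimes>\<^bsub>Q\<^esub> m \<otimes>\<^bsub>Q\<^esub> inv\<^bsub>Q\<^esub> g" for g m
  define L where "L = {g \<in> carrier Q. \<forall>m \<in> M. c g m \<in> M}"
  have xc: "c x m \<in> M" if m: "m \<in> M" for m
  proof -
    have mQ: "m \<in> carrier Q" using m MQ by auto
    \<comment> \<open>Invariance of \<open>C\<close> is recorded for \<open>inv m\<close>; since
      \<open>M\<close> is closed under inverses it also holds for \<open>m\<close> itself.\<close>
    have "M #>\<^bsub>Q\<^esub> (x \<otimes>\<^bsub>Q\<^esub> m) = M #>\<^bsub>Q\<^esub> x"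
      using C(3) subgroup.m_inv_closed[OF M(1) m] x mQ MQ by (force simp: coset_mult_assoc)
    then have "x \<otimes>\<^bsub>Q\<^esub> m \<in> M #>\<^bsub>Q\<^esub> x"
      using rcos_self[OF _ M(1)] x mQ by (metis m_closed)
    then obtain h where h: "h \<in> M" "x \<otimes>\<^bsub>Q\<^esub> m = h \<otimes>\<^bsub>Q\<^esub> x" by (auto simp: r_coset_def)
    then have "c x m = h" using x mQ MQ by (auto simp: c_def m_assoc)
    then show ?thesis using h by simp
  qed
  \<comment> \<open>\<open>L\<close> only asks that conjugation map \<open>M\<close> into itself.
    Finiteness of \<open>M\<close> makes it onto, which closure of \<open>L\<close> under inverses
    relies on.\<close>
  have bij: "c g ` M = M" if g: "g \<in> L" for g
  proof (rule endo_inj_surj)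
    show "finite M" using MQ fin finite_subset by blast
    show "c g ` M \<subseteq> M" using g by (auto simp: L_def)
    show "inj_on (c g) M"
      using g MQ by (auto simp: inj_on_def c_def L_def subset_iff)
  qed
  have subL: "subgroup L Q"
  proof (rule subgroupI)
    show "L \<subseteq> carrier Q" by (auto simp: L_def)
    show "L \<noteq> {}" using x(1) xc by (auto simp: L_def)
  next
    fix g assume g: "g \<in> L"
    have gQ: "g \<in> carrier Q" using g by (simp add: L_def)
    have "c (inv\<^bsub>Q\<^esub> g) m \<in> M" if m: "m \<in> M" for m
    proof -
      obtain m' where m': "m' \<in> M" "m = c g m'" using bij[OF g] m by (metis imageE)
      then have m'Q: "m' \<in> carrier Q" using MQ by auto
      have "inv\<^bsub>Q\<^esub> g \<otimes>\<^bsub>Q\<^esub> (g \<otimes>\<^bsub>Q\<^esub> y) = y" if "y \<in> carrier Q" for y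
        using gQ that by (simp flip: m_assoc)
      then have "c (inv\<^bsub>Q\<^esub> g) m = m'"
        using gQ m'Q by (simp add: m'(2) c_def m_assoc)
      then show ?thesis using m' by simp
    qed
    then show "inv\<^bsub>Q\<^esub> g \<in> L" using gQ by (simp add: L_def)
  next
    fix g h assume gh: "g \<in> L" "h \<in> L"
    have "c (g \<otimes>\<^bsub>Q\<^esub> h) m = c g (c h m)" if "m \<in> carrier Q" for m
      using gh that by (simp add: c_def L_def m_assoc inv_mult_group)
    then show "g \<otimes>\<^bsub>Q\<^esub> h \<in> L" using gh MQ by (auto simp: L_def subset_iff)
  qed
  have "M \<subseteq> L"
    using MQ subgroup.m_closed[OF M(1)] subgroup.m_inv_closed[OF M(1)]
    by (auto simp: L_def c_def)
  moreover have "x \<in> L" using x xc by (simp add: L_def)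
  ultimately have "L = carrier Q" using maximal[OF subL] xM by blast
  then show ?thesis using M(1) unfolding normal_inv_iff L_def c_def by blast
qed

text \<open>By Lagrange a nontrivial element generates the whole group, and powers of one element
  commute.\<close>

lemma (in group) prime_order_imp_comm:
  assumes "Factorial_Ring.prime (order G)"
  shows "comm_group G"
proof -
  have fin: "finite (carrier G)"
    using prime_gt_0_nat[OF assms] by (simp add: order_gt_0_iff_finite)
  have "carrier G \<noteq> {\<one>}" using assms by (auto simp: order_def)
  then obtain y where y: "y \<in> carrier G" "y \<noteq> \<one>" by auto
  have sub: "subgroup (generate G {y}) G" using y by (intro generate_is_subgroup) simp
  have "card (generate G {y}) dvd order G" using lagrange[OF sub] by (metis dvd_triv_right)
  then have "card (generate G {y}) = 1 \<or> card (generate G {y}) = order G"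
    using assms by (simp add: prime_nat_iff)
  moreover have "card (generate G {y}) \<noteq> 1"
  proof
    assume "card (generate G {y}) = 1"
    then obtain z where "generate G {y} = {z}" using card_1_singletonE by blast
    then have "\<one> \<in> {z}" "y \<in> {z}" using generate.one[of G "{y}"] generate.incl[of y "{y}" G] by auto
    then show False using y by simp
  qed
  ultimately have all: "carrier G = generate G {y}" using card_eq_order_subgroup[OF fin sub] by simp
  show ?thesis
  proof (rule group_comm_groupI)
    fix a b assume "a \<in> carrier G" "b \<in> carrier G"
    then obtain i j :: int where "a = y [^] i" "b = y [^] j"
      using all generate_pow[OF y(1)] by auto
    then show "a \<otimes> b = b \<otimes> a" using y by (simp add: int_pow_mult[symmetric] add.commute)
  qed
qed

section \<open>The subgroup \<open>K_p\<close> and its Frattini property\<close>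

lemma (in group) powers_in_carrier: "(\<lambda>g. g [^] (n::nat)) ` carrier G \<subseteq> carrier G"
  by auto

text \<open>A conjugate of a \<open>p\<close>-th power is the \<open>p\<close>-th power of a
  conjugate, so the \<open>p\<close>-th powers generate a normal subgroup, and a product of two
  normal subgroups is normal.\<close>

lemma (in group) K_p_normal: "K_p p G \<lhd> G"
proof -
  have "generate G ((\<lambda>g. g [^] p) ` carrier G) \<lhd> G"
  proof (rule normal_generateI[OF powers_in_carrier])
    fix h g assume "h \<in> (\<lambda>g. g [^] p) ` carrier G" and g: "g \<in> carrier G"
    then obtain x where x: "x \<in> carrier G" "h = x [^] p" by auto
    have "(g \<otimes> x \<otimes> inv g) [^] n = g \<otimes> x [^] n \<otimes> inv g" for n :: nat
    proof (induction n)
      case (Suc n)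
      have "inv g \<otimes> (g \<otimes> y) = y" if "y \<in> carrier G" for y
        using that g by (simp flip: m_assoc)
      then show ?case using x g Suc by (simp add: m_assoc)
    qed (use g in simp)
    then have "g \<otimes> h \<otimes> inv g = (g \<otimes> x \<otimes> inv g) [^] p" using x by simp
    then show "g \<otimes> h \<otimes> inv g \<in> (\<lambda>g. g [^] p) ` carrier G" using x g by auto
  qed
  then show ?thesis
    unfolding K_p_def by (rule normal_subgroup_set_mult_closed[OF derived_self_is_normal])
qed

lemma (in group) commutator_in_K_p:
  assumes "x \<in> carrier G" "y \<in> carrier G"
  shows "x \<otimes> y \<otimes> inv x \<otimes> inv y \<in> K_p p G"
proof -
  have "x \<otimes> y \<otimes> inv x \<otimes> inv y \<in> derived G (carrier G)"
    using assms by (auto simp: derived_def intro!: generate.incl)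
  then have "x \<otimes> y \<otimes> inv x \<otimes> inv y \<otimes> \<one> \<in> K_p p G"
    unfolding K_p_def set_mult_def using generate.one by fast
  then show ?thesis using assms by simp
qed

lemma (in group) power_in_K_p:
  assumes "x \<in> carrier G"
  shows "x [^] p \<in> K_p p G"
proof -
  have "x [^] p \<in> generate G ((\<lambda>g. g [^] p) ` carrier G)"
    using assms by (auto intro!: generate.incl)
  moreover have "\<one> \<in> derived G (carrier G)" by (simp add: derived_def generate.one)
  ultimately have "\<one> \<otimes> x [^] p \<in> K_p p G"
    unfolding K_p_def set_mult_def by fast
  then show ?thesis using assms by simp
qed

text \<open>The universal property that replaces calculations with the product set in the
  definition; it serves for homomorphic images and for maximal subgroups.\<close>

lemma (in group) K_p_minimal:
  assumes "subgroup M G"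
    and "\<And>x y. \<lbrakk>x \<in> carrier G; y \<in> carrier G\<rbrakk> \<Longrightarrow> x \<otimes> y \<otimes> inv x \<otimes> inv y \<in> M"
    and "\<And>x. x \<in> carrier G \<Longrightarrow> x [^] p \<in> M"
  shows "K_p p G \<subseteq> M"
proof -
  have "derived G (carrier G) \<subseteq> M"
    unfolding derived_def by (rule generate_subgroup_incl[OF _ assms(1)]) (use assms(2) in auto)
  moreover have "generate G ((\<lambda>g. g [^] p) ` carrier G) \<subseteq> M"
    by (rule generate_subgroup_incl[OF _ assms(1)]) (use assms(3) in auto)
  ultimately show ?thesis
    using subgroup.m_closed[OF assms(1)] by (auto simp: K_p_def set_mult_def)
qed

text \<open>Homomorphisms preserve commutators and \<open>p\<close>-th powers. For automorphisms
  this makes \<open>K_p\<close> characteristic; for quotient maps it lets membership in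
  \<open>Aut_p\<close> pass to quotients.\<close>

lemma (in group_hom) K_p_img: "h ` K_p p G \<subseteq> K_p p H"
proof -
  have "subgroup {x \<in> carrier G. h x \<in> K_p p H} G"
    using normal_imp_subgroup[OF H.K_p_normal]
    by (intro G.subgroupI)
      (auto intro!: exI[of _ "\<one>\<^bsub>G\<^esub>"] simp: subgroup.one_closed subgroup.m_closed subgroup.m_inv_closed)
  then have "K_p p G \<subseteq> {x \<in> carrier G. h x \<in> K_p p H}"
    by (rule G.K_p_minimal) (auto simp: H.commutator_in_K_p H.power_in_K_p hom_nat_pow)
  then show ?thesis by auto
qed

text \<open>As \<open>M\<close> is normal, \<open>Q Mod M\<close> is a nontrivial p-group and has a
  subgroup of order \<open>p\<close>. The preimage of that subgroup properly contains
  \<open>M\<close>, so it is all of \<open>Q\<close>. Thus \<open>Q Mod M\<close> has order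
  \<open>p\<close>, is abelian and is killed by \<open>p\<close>, and \<open>M\<close> contains all
  commutators and \<open>p\<close>-th powers.\<close>

lemma maximal_subgroup_p_group_contains_K_p:
  assumes p: "Factorial_Ring.prime p" and Q: "finite_p_group p Q"
    and M: "subgroup M Q" "M \<noteq> carrier Q"
    and maximal: "\<And>L. \<lbrakk>subgroup L Q; M \<subset> L\<rbrakk> \<Longrightarrow> L = carrier Q"
  shows "K_p p Q \<subseteq> M"
proof -
  interpret normal M Q by (rule maximal_subgroup_p_group_normal[OF assms])
  let ?R = "Q Mod M"
  interpret R: group ?R by (rule factorgroup_is_group)
  have R: "finite_p_group p ?R" by (rule finite_p_group_Mod[OF p Q normal_axioms])
  then obtain j where j: "order ?R = p ^ j" by (auto simp: finite_p_group_def)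
  have "order ?R \<noteq> 1"
  proof
    assume "order ?R = 1"
    then have "card M = order Q"
      using lagrange[OF M(1)] by (simp add: order_def FactGroup_def)
    then show False
      using card_eq_order_subgroup[OF _ M(1)] M(2) Q by (simp add: finite_p_group_def)
  qed
  \<comment> \<open>Splitting off exactly one factor \<open>p\<close> makes \<open>sylow_thm\<close>
    deliver a subgroup of order \<open>p\<close>.\<close>
  then obtain i where i: "order ?R = p ^ 1 * p ^ i"
    using j by (cases j) auto
  have "finite (carrier ?R)" using R by (simp add: finite_p_group_def)
  then obtain S where S: "subgroup S ?R" "card S = p ^ 1"
    using sylow_thm[OF p R.group_axioms i] by blast
  have char: "\<Union>S = {x \<in> carrier Q. M #>\<^bsub>Q\<^esub> x \<in> S}"
    by (rule factgroup_subgroup_union_char[OF S(1)])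
  have SR: "S \<subseteq> carrier ?R" using S(1) subgroup.subset by blast
  have "M \<subseteq> \<Union>S" using subgroup.one_closed[OF S(1)] by auto
  moreover have "M \<noteq> \<Union>S"
  proof
    assume MS: "M = \<Union>S"
    have "C = M" if C: "C \<in> S" for C
    proof -
      obtain x where x: "x \<in> carrier Q" "C = M #>\<^bsub>Q\<^esub> x" using C SR by (auto simp: carrier_FactGroup)
      then have "x \<in> {x \<in> carrier Q. M #>\<^bsub>Q\<^esub> x \<in> S}" using C by simp
      then have "x \<in> M" unfolding char[symmetric] MS[symmetric] .
      then show ?thesis using x coset_join2[OF x(1) M(1)] by simp
    qed
    then have "S \<subseteq> {M}" by auto
    then have "card S \<le> 1" using card_mono[of "{M}" S] by simp
    then show False using S(2) prime_gt_1_nat[OF p] by simp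
  qed
  ultimately have "\<Union>S = carrier Q"
    using maximal[OF factgroup_subgroup_union_subgroup[OF S(1)]] by blast
  then have "carrier ?R \<subseteq> S" using char by (auto simp: carrier_FactGroup)
  then have oR: "order ?R = p" using SR S(2) by (simp add: order_def subset_antisym)
  then interpret R: comm_group ?R using R.prime_order_imp_comm p by simp
  interpret \<pi>: group_hom Q ?R "\<lambda>x. M #>\<^bsub>Q\<^esub> x"
    using r_coset_hom_Mod by unfold_locales
  have mem: "x \<in> M" if "x \<in> carrier Q" "M #>\<^bsub>Q\<^esub> x = M" for x
    using that coset_join1[OF _ _ M(1)] by blast
  show ?thesis
  proof (rule K_p_minimal[OF M(1)])
    fix x y assume xy: "x \<in> carrier Q" "y \<in> carrier Q"
    let ?x = "M #>\<^bsub>Q\<^esub> x" and ?y = "M #>\<^bsub>Q\<^esub> y"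
    have c: "?x \<in> carrier ?R" "?y \<in> carrier ?R" using xy by auto
    have "M #>\<^bsub>Q\<^esub> (x \<otimes>\<^bsub>Q\<^esub> y \<otimes>\<^bsub>Q\<^esub> inv\<^bsub>Q\<^esub> x \<otimes>\<^bsub>Q\<^esub> inv\<^bsub>Q\<^esub> y)
        = ?x \<otimes>\<^bsub>?R\<^esub> ?y \<otimes>\<^bsub>?R\<^esub> inv\<^bsub>?R\<^esub> ?x \<otimes>\<^bsub>?R\<^esub> inv\<^bsub>?R\<^esub> ?y"
      using xy by (simp only: \<pi>.hom_mult \<pi>.hom_inv m_closed inv_closed)
    also have "\<dots> = (?x \<otimes>\<^bsub>?R\<^esub> inv\<^bsub>?R\<^esub> ?x) \<otimes>\<^bsub>?R\<^esub> (?y \<otimes>\<^bsub>?R\<^esub> inv\<^bsub>?R\<^esub> ?y)"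
      using c by (simp only: R.m_ac R.m_closed R.inv_closed)
    also have "\<dots> = \<one>\<^bsub>?R\<^esub>" using c by (simp only: R.r_inv R.l_one R.one_closed)
    finally have "M #>\<^bsub>Q\<^esub> (x \<otimes>\<^bsub>Q\<^esub> y \<otimes>\<^bsub>Q\<^esub> inv\<^bsub>Q\<^esub> x \<otimes>\<^bsub>Q\<^esub> inv\<^bsub>Q\<^esub> y) = M" by simp
    then show "x \<otimes>\<^bsub>Q\<^esub> y \<otimes>\<^bsub>Q\<^esub> inv\<^bsub>Q\<^esub> x \<otimes>\<^bsub>Q\<^esub> inv\<^bsub>Q\<^esub> y \<in> M" using xy by (intro mem) auto
  next
    fix x assume x: "x \<in> carrier Q"
    have "M #>\<^bsub>Q\<^esub> (x [^]\<^bsub>Q\<^esub> p) = (M #>\<^bsub>Q\<^esub> x) [^]\<^bsub>?R\<^esub> p" using FactGroup_pow[OF x] by simp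
    also have "\<dots> = \<one>\<^bsub>?R\<^esub>" using R.pow_order_eq_1[of "M #>\<^bsub>Q\<^esub> x"] oR x \<pi>.hom_closed by simp
    finally have "M #>\<^bsub>Q\<^esub> (x [^]\<^bsub>Q\<^esub> p) = M" by simp
    then show "x [^]\<^bsub>Q\<^esub> p \<in> M" using x by (intro mem) auto
  qed
qed

text \<open>A proper subgroup lies in a maximal one, which contains \<open>K_p\<close>. Hence a
  subgroup that generates \<open>Q\<close> together with \<open>K_p\<close> is already
  \<open>Q\<close>.\<close>

lemma p_group_proper_subgroup:
  assumes p: "Factorial_Ring.prime p" and Q: "finite_p_group p Q"
    and H: "subgroup H Q" "H \<noteq> carrier Q"
  obtains M where "subgroup M Q" "H \<subseteq> M" "K_p p Q \<subseteq> M" "M \<noteq> carrier Q"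
proof -
  interpret group Q using Q by (simp add: finite_p_group_def)
  let ?F = "{M. subgroup M Q \<and> M \<noteq> carrier Q}"
  have "?F \<subseteq> Pow (carrier Q)" using subgroup.subset by blast
  then have "finite ?F" using Q by (auto simp: finite_p_group_def intro: finite_subset)
  then obtain M where M: "M \<in> ?F" "H \<subseteq> M" "\<forall>L \<in> ?F. M \<subseteq> L \<longrightarrow> L = M"
    using finite_has_maximal2[of ?F H] H by auto
  then have "K_p p Q \<subseteq> M"
    by (intro maximal_subgroup_p_group_contains_K_p[OF p Q]) auto
  then show thesis using that M by auto
qed

subsection \<open>Automorphisms\<close>

lemma carrier_AutoGroup [simp]: "carrier (AutoGroup G) = auto G"
  by (simp add: AutoGroup_def)

lemma one_AutoGroup: "\<one>\<^bsub>AutoGroup G\<^esub> = (\<lambda>x \<in> carrier G. x)"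
  by (simp add: AutoGroup_def BijGroup_def)

lemma mult_AutoGroup:
  "\<lbrakk>\<psi> \<in> auto G; \<chi> \<in> auto G\<rbrakk> \<Longrightarrow> \<psi> \<otimes>\<^bsub>AutoGroup G\<^esub> \<chi> = compose (carrier G) \<psi> \<chi>"
  by (simp add: AutoGroup_def BijGroup_def auto_def)

lemma auto_eqI:
  assumes "\<psi> \<in> auto G" "\<chi> \<in> auto G" "\<And>x. x \<in> carrier G \<Longrightarrow> \<psi> x = \<chi> x"
  shows "\<psi> = \<chi>"
  using assms by (auto simp: auto_def Bij_def intro: extensionalityI)

lemma (in group) autoI:
  assumes "f \<in> hom G G" "inj_on f (carrier G)" "carrier G \<subseteq> f ` carrier G" "f \<in> extensional (carrier G)"
  shows "f \<in> auto G"
  using assms by (auto simp: auto_def Bij_def bij_betw_def hom_def)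

lemma auto_hom: "\<psi> \<in> auto G \<Longrightarrow> \<psi> \<in> hom G G"
  by (simp add: auto_def)

lemma auto_closed: "\<lbrakk>\<psi> \<in> auto G; x \<in> carrier G\<rbrakk> \<Longrightarrow> \<psi> x \<in> carrier G"
  by (auto simp: auto_def intro: hom_in_carrier)

lemma auto_image: "\<psi> \<in> auto G \<Longrightarrow> \<psi> ` carrier G = carrier G"
  by (simp add: auto_def Bij_def bij_betw_def)

lemma auto_inj_on: "\<psi> \<in> auto G \<Longrightarrow> inj_on \<psi> (carrier G)"
  by (simp add: auto_def Bij_def bij_betw_def)

lemma (in group) auto_group_hom: "\<psi> \<in> auto G \<Longrightarrow> group_hom G G \<psi>"
  by (simp add: group_hom_def group_hom_axioms_def auto_hom)

lemma (in group) auto_inverse: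
  assumes "\<psi> \<in> auto G"
  obtains \<chi> where "\<chi> \<in> auto G" "\<And>x. x \<in> carrier G \<Longrightarrow> \<chi> (\<psi> x) = x"
    "\<And>x. x \<in> carrier G \<Longrightarrow> \<psi> (\<chi> x) = x"
proof -
  interpret A: group "AutoGroup G" by (rule AutoGroup)
  let ?\<chi> = "inv\<^bsub>AutoGroup G\<^esub> \<psi>"
  have \<chi>: "?\<chi> \<in> auto G" using A.inv_closed[of \<psi>] assms by simp
  have "compose (carrier G) ?\<chi> \<psi> = (\<lambda>x \<in> carrier G. x)"
    "compose (carrier G) \<psi> ?\<chi> = (\<lambda>x \<in> carrier G. x)"
    using A.l_inv[of \<psi>] A.r_inv[of \<psi>] assms \<chi> by (simp_all add: mult_AutoGroup one_AutoGroup)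
  then show thesis using that[OF \<chi>] by (metis compose_eq restrict_apply')
qed

text \<open>Inclusion for the inverse automorphism yields the reverse inclusion.\<close>

lemma (in group) characteristicI:
  assumes "subgroup K G" "\<And>\<psi> x. \<lbrakk>\<psi> \<in> auto G; x \<in> K\<rbrakk> \<Longrightarrow> \<psi> x \<in> K"
  shows "characteristic K G"
  unfolding characteristic_def
proof (intro conjI ballI)
  fix \<psi> assume \<psi>: "\<psi> \<in> auto G"
  obtain \<chi> where \<chi>: "\<chi> \<in> auto G" "\<And>x. x \<in> carrier G \<Longrightarrow> \<psi> (\<chi> x) = x"
    using auto_inverse[OF \<psi>] by metis
  have "x \<in> \<psi> ` K" if "x \<in> K" for x
    using that \<chi> assms subgroup.subset[OF assms(1)] by (intro image_eqI[of _ _ "\<chi> x"]) auto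
  then show "\<psi> ` K = K" using assms(2)[OF \<psi>] by auto
qed (rule assms(1))

lemma (in group) conj_auto:
  assumes "g \<in> carrier G"
  shows "(\<lambda>x \<in> carrier G. g \<otimes> x \<otimes> inv g) \<in> auto G"
proof (rule autoI)
  let ?c = "\<lambda>x \<in> carrier G. g \<otimes> x \<otimes> inv g"
  have 1: "inv g \<otimes> (g \<otimes> y) = y" "g \<otimes> (inv g \<otimes> y) = y" if "y \<in> carrier G" for y
    using that assms by (simp_all flip: m_assoc)
  show "?c \<in> hom G G" using assms by (auto intro!: homI simp: m_assoc 1)
  show "inj_on ?c (carrier G)" using assms by (auto simp: inj_on_def)
  show "carrier G \<subseteq> ?c ` carrier G"
  proof
    fix x assume "x \<in> carrier G"
    then show "x \<in> ?c ` carrier G"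
      using assms by (intro image_eqI[of _ _ "inv g \<otimes> x \<otimes> g"]) (simp_all add: m_assoc 1)
  qed
qed simp

lemma (in group) inn_subset_auto: "inn G \<subseteq> auto G"
  using conj_auto by (auto simp: inn_def)

lemma innE:
  assumes "\<psi> \<in> inn G"
  obtains g where "g \<in> carrier G" "\<And>x. x \<in> carrier G \<Longrightarrow> \<psi> x = g \<otimes>\<^bsub>G\<^esub> x \<otimes>\<^bsub>G\<^esub> inv\<^bsub>G\<^esub> g"
  using assms by (auto simp: inn_def)

lemma (in group) innI:
  assumes "\<psi> \<in> auto G" "g \<in> carrier G" "\<And>x. x \<in> carrier G \<Longrightarrow> \<psi> x = g \<otimes> x \<otimes> inv g"
  shows "\<psi> \<in> inn G"
proof -
  have "\<psi> = (\<lambda>x \<in> carrier G. g \<otimes> x \<otimes> inv g)"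
    using assms by (intro auto_eqI[OF _ conj_auto]) auto
  then show ?thesis using assms(2) by (auto simp: inn_def)
qed

lemma (in group) characteristic_imp_normal:
  assumes "characteristic K G"
  shows "K \<lhd> G"
proof (rule normal_invI)
  show K: "subgroup K G" using assms by (simp add: characteristic_def)
  fix x h assume x: "x \<in> carrier G" "h \<in> K"
  have "(\<lambda>y \<in> carrier G. x \<otimes> y \<otimes> inv x) ` K = K"
    using assms conj_auto[OF x(1)] unfolding characteristic_def by blast
  then show "x \<otimes> h \<otimes> inv x \<in> K"
    using x subgroup.subset[OF K] by (metis image_eqI restrict_apply' subsetD)
qed

lemma (in group) inn_normal: "inn G \<lhd> AutoGroup G"
proof -
  interpret A: group "AutoGroup G" by (rule AutoGroup)
  let ?c = "\<lambda>g. \<lambda>x \<in> carrier G. g \<otimes> x \<otimes> inv g"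
  have "?c \<in> hom G (AutoGroup G)"
  proof (rule homI)
    fix g h assume gh: "g \<in> carrier G" "h \<in> carrier G"
    show "?c (g \<otimes> h) = ?c g \<otimes>\<^bsub>AutoGroup G\<^esub> ?c h"
      using gh by (auto simp: mult_AutoGroup conj_auto compose_def fun_eq_iff m_assoc inv_mult_group)
  qed (simp add: conj_auto)
  then interpret c: group_hom G "AutoGroup G" ?c by unfold_locales
  show ?thesis
  proof (rule A.normal_invI)
    show "subgroup (inn G) (AutoGroup G)" unfolding inn_def by (rule c.img_is_subgroup)
    fix \<psi> \<iota> assume \<psi>: "\<psi> \<in> carrier (AutoGroup G)" and \<iota>: "\<iota> \<in> inn G"
    obtain g where g: "g \<in> carrier G" "\<iota> = ?c g" using \<iota> by (auto simp: inn_def)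
    have \<psi>': "\<psi> \<in> auto G" using \<psi> by simp
    interpret \<psi>: group_hom G G \<psi> by (rule auto_group_hom[OF \<psi>'])
    \<comment> \<open>An automorphism carries conjugation by \<open>g\<close> to conjugation by
      \<open>\<psi> g\<close>. Stated without the inverse of \<open>\<psi>\<close>, this is a
      pointwise identity.\<close>
    have "\<psi> \<otimes>\<^bsub>AutoGroup G\<^esub> ?c g = ?c (\<psi> g) \<otimes>\<^bsub>AutoGroup G\<^esub> \<psi>"
      using g \<psi>' by (auto simp: mult_AutoGroup conj_auto compose_def fun_eq_iff)
    then have "\<psi> \<otimes>\<^bsub>AutoGroup G\<^esub> \<iota> \<otimes>\<^bsub>AutoGroup G\<^esub> inv\<^bsub>AutoGroup G\<^esub> \<psi> = ?c (\<psi> g)"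
      using g \<psi> c.hom_closed[OF \<psi>.hom_closed[OF g(1)]] c.hom_closed[OF g(1)]
      by (metis A.inv_solve_right' A.m_closed)
    then show "\<psi> \<otimes>\<^bsub>AutoGroup G\<^esub> \<iota> \<otimes>\<^bsub>AutoGroup G\<^esub> inv\<^bsub>AutoGroup G\<^esub> \<psi> \<in> inn G"
      using g by (auto simp: inn_def)
  qed
qed

section \<open>Automorphisms induced on characteristic quotients\<close>

lemma (in group) induced_auto_in_auto:
  assumes K: "characteristic K G" and \<psi>: "\<psi> \<in> auto G"
  shows "induced_auto G K \<psi> \<in> auto (G Mod K)"
proof -
  interpret normal K G by (rule characteristic_imp_normal[OF K])
  interpret Q: group "G Mod K" by (rule factorgroup_is_group)
  interpret \<psi>: group_hom G G \<psi> by (rule auto_group_hom[OF \<psi>])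
  note coset = induced_auto_coset[OF group_axioms K]
  obtain \<chi> where \<chi>: "\<chi> \<in> auto G" "\<And>x. x \<in> carrier G \<Longrightarrow> \<chi> (\<psi> x) = x"
    "\<And>x. x \<in> carrier G \<Longrightarrow> \<psi> (\<chi> x) = x"
    using auto_inverse[OF \<psi>] by metis
  show ?thesis
  proof (rule Q.autoI)
    show "induced_auto G K \<psi> \<in> hom (G Mod K) (G Mod K)"
      by (rule homI) (auto simp: carrier_FactGroup coset[OF \<psi>] rcos_sum)
    have "induced_auto G K \<chi> (induced_auto G K \<psi> C) = C" if "C \<in> carrier (G Mod K)" for C
      using that by (auto simp: carrier_FactGroup coset[OF \<psi>] coset[OF \<chi>(1)] \<chi>(2))
    then show "inj_on (induced_auto G K \<psi>) (carrier (G Mod K))" by (metis inj_on_inverseI)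
    show "carrier (G Mod K) \<subseteq> induced_auto G K \<psi> ` carrier (G Mod K)"
    proof
      fix C assume "C \<in> carrier (G Mod K)"
      then obtain x where x: "x \<in> carrier G" "C = K #> x" by (auto simp: carrier_FactGroup)
      then have "C = induced_auto G K \<psi> (K #> \<chi> x)" "K #> \<chi> x \<in> carrier (G Mod K)"
        using \<chi> auto_closed[OF \<chi>(1)] by (auto simp: carrier_FactGroup coset[OF \<psi>])
      then show "C \<in> induced_auto G K \<psi> ` carrier (G Mod K)" by blast
    qed
  qed (simp add: induced_auto_def)
qed

lemma (in group) induced_auto_group_hom:
  assumes K: "characteristic K G"
  shows "group_hom (AutoGroup G) (AutoGroup (G Mod K)) (induced_auto G K)"
proof -
  interpret normal K G by (rule characteristic_imp_normal[OF K])
  interpret Q: group "G Mod K" by (rule factorgroup_is_group)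
  note coset = induced_auto_coset[OF group_axioms K]
  interpret A: group "AutoGroup G" by (rule AutoGroup)
  have "induced_auto G K \<in> hom (AutoGroup G) (AutoGroup (G Mod K))"
  proof (rule homI)
    fix \<psi> \<chi> assume "\<psi> \<in> carrier (AutoGroup G)" "\<chi> \<in> carrier (AutoGroup G)"
    then have a: "\<psi> \<in> auto G" "\<chi> \<in> auto G" by auto
    then have m: "compose (carrier G) \<psi> \<chi> \<in> auto G"
      using A.m_closed[of \<psi> \<chi>] by (simp add: mult_AutoGroup)
    have i: "induced_auto G K \<psi> \<in> auto (G Mod K)" "induced_auto G K \<chi> \<in> auto (G Mod K)"
      using induced_auto_in_auto[OF K] a by auto
    have "induced_auto G K (compose (carrier G) \<psi> \<chi>) C
        = compose (carrier (G Mod K)) (induced_auto G K \<psi>) (induced_auto G K \<chi>) C"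
      if C: "C \<in> carrier (G Mod K)" for C
    proof -
      obtain x where x: "x \<in> carrier G" "C = K #> x" using C by (auto simp: carrier_FactGroup)
      show ?thesis
        unfolding compose_eq[OF C] unfolding x(2) coset[OF a(2) x(1)] coset[OF m x(1)]
          compose_eq[OF x(1)] coset[OF a(1) auto_closed[OF a(2) x(1)]] ..
    qed
    moreover have "induced_auto G K (compose (carrier G) \<psi> \<chi>) \<in> extensional (carrier (G Mod K))"
      "compose (carrier (G Mod K)) (induced_auto G K \<psi>) (induced_auto G K \<chi>) \<in> extensional (carrier (G Mod K))"
      by (simp_all add: induced_auto_def)
    ultimately show "induced_auto G K (\<psi> \<otimes>\<^bsub>AutoGroup G\<^esub> \<chi>)
        = induced_auto G K \<psi> \<otimes>\<^bsub>AutoGroup (G Mod K)\<^esub> induced_auto G K \<chi>"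
      using a i by (auto simp: mult_AutoGroup intro: extensionalityI)
  qed (use induced_auto_in_auto[OF K] in simp)
  then show ?thesis
    using AutoGroup Q.AutoGroup by (simp add: group_hom_def group_hom_axioms_def)
qed

lemma (in group) induced_auto_inn:
  assumes K: "characteristic K G" and \<psi>: "\<psi> \<in> inn G"
  shows "induced_auto G K \<psi> \<in> inn (G Mod K)"
proof -
  interpret normal K G by (rule characteristic_imp_normal[OF K])
  interpret Q: group "G Mod K" by (rule factorgroup_is_group)
  interpret \<pi>: group_hom G "G Mod K" "\<lambda>x. K #> x"
    using r_coset_hom_Mod by unfold_locales
  have a: "\<psi> \<in> auto G" using \<psi> inn_subset_auto by auto
  obtain g where g: "g \<in> carrier G" "\<And>x. x \<in> carrier G \<Longrightarrow> \<psi> x = g \<otimes> x \<otimes> inv g"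
    using innE[OF \<psi>] by metis
  show ?thesis
  proof (rule Q.innI[OF induced_auto_in_auto[OF K a] \<pi>.hom_closed[OF g(1)]])
    fix C assume "C \<in> carrier (G Mod K)"
    then obtain x where x: "x \<in> carrier G" "C = K #> x" by (auto simp: carrier_FactGroup)
    show "induced_auto G K \<psi> C = (K #> g) \<otimes>\<^bsub>G Mod K\<^esub> C \<otimes>\<^bsub>G Mod K\<^esub> inv\<^bsub>G Mod K\<^esub> (K #> g)"
      unfolding x(2) induced_auto_coset[OF group_axioms K a x(1)] g(2)[OF x(1)]
      using x(1) g(1) by (simp only: \<pi>.hom_mult \<pi>.hom_inv monoid.m_closed[OF group.is_monoid[OF group_axioms]]
          group.inv_closed[OF group_axioms])
  qed
qed

subsection \<open>The groups \<open>Aut\<^sub>p\<close> and \<open>Out\<^sub>p\<close>\<close>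

lemma (in group) K_p_characteristic: "characteristic (K_p p G) G"
proof (rule characteristicI)
  show "subgroup (K_p p G) G" using K_p_normal normal_imp_subgroup by blast
  fix \<psi> x assume "\<psi> \<in> auto G" "x \<in> K_p p G"
  then show "\<psi> x \<in> K_p p G" using group_hom.K_p_img[OF auto_group_hom] by blast
qed

lemma (in group) Aut_p_normal: "Aut_p p G \<lhd> AutoGroup G"
  unfolding Aut_p_def
  by (rule group_hom.normal_kernel[OF induced_auto_group_hom[OF K_p_characteristic]])

text \<open>Acting trivially on \<open>G Mod K_p p G\<close> means keeping each \<open>x\<close> in
  its own coset. This elementwise form is easier to handle than the kernel of maps between
  automorphism groups.\<close>

lemma (in group) Aut_p_iff:
  "\<psi> \<in> Aut_p p G \<longleftrightarrow> \<psi> \<in> auto G \<and> (\<forall>x \<in> carrier G. \<psi> x \<otimes> inv x \<in> K_p p G)"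
proof (cases "\<psi> \<in> auto G")
  case True
  let ?K = "K_p p G"
  interpret normal ?K G by (rule K_p_normal)
  have "\<psi> \<in> Aut_p p G \<longleftrightarrow> induced_auto G ?K \<psi> = (\<lambda>C \<in> carrier (G Mod ?K). C)"
    using True by (simp add: Aut_p_def kernel_def one_AutoGroup)
  also have "\<dots> \<longleftrightarrow> (\<forall>C \<in> carrier (G Mod ?K). induced_auto G ?K \<psi> C = C)"
    by (auto simp: induced_auto_def fun_eq_iff restrict_def)
  also have "\<dots> \<longleftrightarrow> (\<forall>x \<in> carrier G. ?K #> \<psi> x = ?K #> x)"
    using induced_auto_coset[OF group_axioms K_p_characteristic True] by (simp add: carrier_FactGroup)
  also have "\<dots> \<longleftrightarrow> (\<forall>x \<in> carrier G. \<psi> x \<otimes> inv x \<in> ?K)"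
  proof (rule ball_cong[OF refl])
    fix x assume x: "x \<in> carrier G"
    have px: "\<psi> x \<in> carrier G" using True x by (rule auto_closed)
    have "?K #> \<psi> x = ?K #> x \<longleftrightarrow> \<psi> x \<in> ?K #> x"
      using x px repr_independence[OF _ x is_subgroup] rcos_self[OF px is_subgroup] by auto
    then show "?K #> \<psi> x = ?K #> x \<longleftrightarrow> \<psi> x \<otimes> inv x \<in> ?K"
      using rcos_module[OF group_axioms x px] by simp
  qed
  finally show ?thesis using True by simp
qed (simp add: Aut_p_def kernel_def)

lemma (in group) inn_subset_Aut_p: "inn G \<subseteq> Aut_p p G"
proof
  fix \<psi> assume \<psi>: "\<psi> \<in> inn G"
  then obtain g where g: "g \<in> carrier G" "\<And>x. x \<in> carrier G \<Longrightarrow> \<psi> x = g \<otimes> x \<otimes> inv g"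
    using innE by metis
  then show "\<psi> \<in> Aut_p p G"
    using \<psi> inn_subset_auto commutator_in_K_p by (auto simp: Aut_p_iff)
qed

lemma (in group) Aut_p_group: "group ((AutoGroup G)\<lparr>carrier := Aut_p p G\<rparr>)"
  using group.subgroup_imp_group[OF AutoGroup normal_imp_subgroup[OF Aut_p_normal]] .

lemma (in group) inn_normal_Aut_p: "inn G \<lhd> (AutoGroup G)\<lparr>carrier := Aut_p p G\<rparr>"
  by (rule group.normal_restrict_supergroup[OF AutoGroup normal_imp_subgroup[OF Aut_p_normal]
        inn_normal inn_subset_Aut_p])

lemma (in group) Out_p_group: "group (Out_p p G)"
  unfolding Out_p_def by (rule normal.factorgroup_is_group[OF inn_normal_Aut_p])

lemma (in group) Out_group: "group (Out G)"
  unfolding Out_def by (rule normal.factorgroup_is_group[OF inn_normal])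

lemma (in group) carrier_Out_p: "carrier (Out_p p G) = (\<lambda>\<psi>. inn G #>\<^bsub>AutoGroup G\<^esub> \<psi>) ` Aut_p p G"
  by (simp add: Out_p_def carrier_FactGroup)

lemma (in group) Out_p_subgroup: "subgroup (carrier (Out_p p G)) (Out G)"
  using group.normal_subgroup_factorize[OF AutoGroup inn_normal inn_subset_Aut_p
      normal_imp_subgroup[OF Aut_p_normal]]
  by (simp add: Out_p_def Out_def FactGroup_def)

text \<open>Both quotients multiply cosets by the same formula, so \<open>Out_p\<close> is
  \<open>Out\<close> with a smaller carrier. This is the shape in which
  \<open>virtually_residually_p_finite\<close> presents a subgroup.\<close>

lemma (in group) Out_p_eq: "Out_p p G = (Out G)\<lparr>carrier := carrier (Out_p p G)\<rparr>"
  by (simp add: Out_p_def Out_def FactGroup_def set_mult_def fun_eq_iff)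

section \<open>Hall's theorem: \<open>Aut_p\<close> of a finite p-group is a p-group\<close>

text \<open>All stabilizers are trivial, so every orbit has exactly as many elements as the
  group.\<close>

lemma (in group_action) semiregular_order_dvd_card:
  assumes "finite E" "\<And>g x. \<lbrakk>g \<in> carrier G; x \<in> E; \<phi> g x = x\<rbrakk> \<Longrightarrow> g = \<one>"
  shows "order G dvd card E"
proof -
  interpret group G using group_hom by (simp add: group_hom_def)
  have "order G dvd card O'" if O': "O' \<in> orbits G E \<phi>" for O'
  proof -
    obtain x where x: "x \<in> E" "O' = orbit G \<phi> x" using O' by (auto simp: orbits_def)
    have "\<phi> \<one> x = x" using id_eq_one x by (metis restrict_apply')
    then have "stabilizer G \<phi> x = {\<one>}" using assms(2) x by (auto simp: stabilizer_def)
    then show ?thesis using orbit_stabilizer_theorem[OF x(1)] x(2) by simp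
  qed
  moreover have "card E = (\<Sum>O' \<in> orbits G E \<phi>. card O')"
    using disjoint_sum[OF assms(1), of "\<lambda>_. 1::nat"] by simp
  ultimately show ?thesis by (simp add: dvd_sum)
qed

text \<open>\<^term>\<open>Aut_p p Q\<close> acts on the families \<open>t\<close> with \<open>t x \<in> x K\<^sub>p\<close>. By the Frattini property of
  \<open>K\<^sub>p\<close> every such family generates \<open>Q\<close>, so only the identity fixes one; hence the order of
  \<^term>\<open>Aut_p p Q\<close> divides the number of families, which is a power of \<open>p\<close>.\<close>

lemma finite_p_group_Aut_p:
  assumes p: "Factorial_Ring.prime p" and Q: "finite_p_group p Q"
  shows "finite_p_group p ((AutoGroup Q)\<lparr>carrier := Aut_p p Q\<rparr>)"
proof -
  interpret group Q using Q by (simp add: finite_p_group_def)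
  let ?K = "K_p p Q" and ?P = "(AutoGroup Q)\<lparr>carrier := Aut_p p Q\<rparr>"
  interpret P: group ?P by (rule Aut_p_group)
  interpret K: normal ?K Q by (rule K_p_normal)
  have fin: "finite (carrier Q)" using Q by (simp add: finite_p_group_def)
  \<comment> \<open>Families are indexed by the whole carrier, so no generating set has to be
    chosen.\<close>
  let ?E = "Pi\<^sub>E (carrier Q) (\<lambda>x. ?K #>\<^bsub>Q\<^esub> x)"
  let ?\<phi> = "\<lambda>\<psi>. \<lambda>t \<in> ?E. \<lambda>x \<in> carrier Q. \<psi> (t x)"
  have KQ: "?K #>\<^bsub>Q\<^esub> x \<subseteq> carrier Q" if "x \<in> carrier Q" for x
    using that K.subset by (rule r_coset_subset_G[rotated])
  have act: "\<psi> y \<in> ?K #>\<^bsub>Q\<^esub> x" if "\<psi> \<in> Aut_p p Q" "x \<in> carrier Q" "y \<in> ?K #>\<^bsub>Q\<^esub> x" for \<psi> x y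
  proof -
    have \<psi>: "\<psi> \<in> auto Q" and y: "y \<in> carrier Q" using that KQ by (auto simp: Aut_p_iff)
    have "\<psi> y \<otimes>\<^bsub>Q\<^esub> inv\<^bsub>Q\<^esub> y \<in> ?K" using that y by (simp add: Aut_p_iff)
    then have "\<psi> y \<in> ?K #>\<^bsub>Q\<^esub> y"
      using K.rcos_module[OF group_axioms y] auto_closed[OF \<psi> y] by simp
    then show ?thesis using repr_independence[OF that(3) that(2) K.is_subgroup] by simp
  qed
  have cl: "?\<phi> \<psi> t \<in> ?E" if "\<psi> \<in> Aut_p p Q" "t \<in> ?E" for \<psi> t
    using that act by (auto simp: PiE_def Pi_def)
  have tQ: "t x \<in> carrier Q" if "t \<in> ?E" "x \<in> carrier Q" for t x
    using that KQ by (auto simp: PiE_def Pi_def)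
  interpret A: group_action ?P ?E ?\<phi>
  proof (rule group_actionI[OF Aut_p_group])
    fix \<psi> t assume "\<psi> \<in> carrier ?P" "t \<in> ?E"
    then show "?\<phi> \<psi> t \<in> ?E" by (intro cl) simp_all
  next
    fix \<psi> \<chi> t assume "\<psi> \<in> carrier ?P" "\<chi> \<in> carrier ?P" and t: "t \<in> ?E"
    then have a: "\<psi> \<in> Aut_p p Q" "\<chi> \<in> Aut_p p Q" by auto
    then have "\<psi> \<in> auto Q" "\<chi> \<in> auto Q" by (auto simp: Aut_p_iff)
    then show "?\<phi> (\<psi> \<otimes>\<^bsub>?P\<^esub> \<chi>) t = ?\<phi> \<psi> (?\<phi> \<chi> t)"
      unfolding restrict_apply'[OF t] restrict_apply'[OF cl[OF a(2) t], unfolded restrict_apply'[OF t]]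
      using tQ[OF t] by (simp add: mult_AutoGroup compose_eq cong: restrict_cong)
  next
    fix t assume t: "t \<in> ?E"
    then have "(\<lambda>x \<in> carrier Q. t x) = t" by (intro extensional_restrict) (simp add: PiE_def)
    then show "?\<phi> \<one>\<^bsub>?P\<^esub> t = t"
      using tQ[OF t] t by (simp add: one_AutoGroup cong: restrict_cong)
  qed simp
  have finE: "finite ?E"
    using fin KQ by (intro finite_PiE) (auto intro: finite_subset)
  have "\<psi> = \<one>\<^bsub>?P\<^esub>" if \<psi>: "\<psi> \<in> carrier ?P" and t: "t \<in> ?E" "?\<phi> \<psi> t = t" for \<psi> t
  proof -
    have a: "\<psi> \<in> auto Q" using \<psi> by (simp add: Aut_p_iff)
    interpret \<psi>: group_hom Q Q \<psi> by (rule auto_group_hom[OF a])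
    let ?F = "{x \<in> carrier Q. \<psi> x = x}"
    have F: "subgroup ?F Q"
      by (rule subgroupI) (auto intro!: exI[of _ "\<one>\<^bsub>Q\<^esub>"])
    have "?F = carrier Q"
    proof (rule ccontr)
      assume "?F \<noteq> carrier Q"
      then obtain M where M: "subgroup M Q" "?F \<subseteq> M" "?K \<subseteq> M" "M \<noteq> carrier Q"
        using p_group_proper_subgroup[OF p Q F] by metis
      \<comment> \<open>Being fixed, \<open>t x\<close> lies in \<open>?F\<close> and hence in
        \<open>M\<close>; \<open>x\<close> differs from it by an element of \<open>K_p\<close>,
        which is in \<open>M\<close> too.\<close>
      have "x \<in> M" if x: "x \<in> carrier Q" for x
      proof -
        have tx: "t x \<in> ?K #>\<^bsub>Q\<^esub> x" using t x by auto
        have "\<psi> (t x) = t x" using t x by (metis (mono_tags, lifting) restrict_apply')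
        then have tM: "t x \<in> M" using M(2) tx KQ[OF x] by auto
        obtain k where k: "k \<in> ?K" "t x = k \<otimes>\<^bsub>Q\<^esub> x" using tx by (auto simp: r_coset_def)
        then have "x = inv\<^bsub>Q\<^esub> k \<otimes>\<^bsub>Q\<^esub> t x" using x by (simp flip: m_assoc)
        then show ?thesis
          using tM k(1) M by (metis subgroup.m_closed subgroup.m_inv_closed subsetD)
      qed
      then show False using M subgroup.subset[OF M(1)] by auto
    qed
    then have "\<psi> x = x" if "x \<in> carrier Q" for x using that by auto
    then have "\<psi> = (\<lambda>x \<in> carrier Q. x)" by (intro auto_eqI[OF a id_in_auto]) auto
    then show ?thesis by (simp add: one_AutoGroup)
  qed
  then have dvd: "order ?P dvd card ?E" using A.semiregular_order_dvd_card[OF finE] by blast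
  have "card (?K #>\<^bsub>Q\<^esub> x) = card ?K" if "x \<in> carrier Q" for x
    using card_rcosets_equal[OF rcosetsI[OF K.subset that] K.subset] by simp
  then have cE: "card ?E = card ?K ^ card (carrier Q)"
    using fin by (simp add: card_PiE)
  obtain n where "order (Q\<lparr>carrier := ?K\<rparr>) = p ^ n"
    using finite_p_group_subgroup[OF p Q K.is_subgroup] by (auto simp: finite_p_group_def)
  then have "card ?E = p ^ (n * card (carrier Q))" using cE by (simp add: order_def power_mult)
  then have "\<exists>k. order ?P = p ^ k" using dvd divides_primepow_nat[OF p] by metis
  \<comment> \<open>An infinite carrier would have order 0, which is not a power of
    \<open>p\<close>.\<close>
  moreover have "finite (carrier ?P)"
    using calculation prime_gt_0_nat[OF p] P.order_gt_0_iff_finite by auto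
  ultimately show ?thesis by (simp add: finite_p_group_def P.group_axioms)
qed

lemma finite_p_group_Out_p:
  assumes "Factorial_Ring.prime p" "finite_p_group p Q"
  shows "finite_p_group p (Out_p p Q)"
  unfolding Out_p_def
  using assms group.inn_normal_Aut_p
  by (intro finite_p_group_Mod finite_p_group_Aut_p) (auto simp: finite_p_group_def)

section \<open>Finite p-quotients of \<open>Out_p\<close>\<close>

lemma (in group) induced_auto_Aut_p:
  assumes K: "characteristic K G" and \<psi>: "\<psi> \<in> Aut_p p G"
  shows "induced_auto G K \<psi> \<in> Aut_p p (G Mod K)"
proof -
  interpret normal K G by (rule characteristic_imp_normal[OF K])
  interpret Q: group "G Mod K" by (rule factorgroup_is_group)
  interpret \<pi>: group_hom G "G Mod K" "\<lambda>x. K #> x"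
    using r_coset_hom_Mod by unfold_locales
  have a: "\<psi> \<in> auto G" using \<psi> by (simp add: Aut_p_iff)
  have "induced_auto G K \<psi> C \<otimes>\<^bsub>G Mod K\<^esub> inv\<^bsub>G Mod K\<^esub> C \<in> K_p p (G Mod K)"
    if C: "C \<in> carrier (G Mod K)" for C
  proof -
    obtain x where x: "x \<in> carrier G" "C = K #> x" using C by (auto simp: carrier_FactGroup)
    have "\<psi> x \<otimes> inv x \<in> K_p p G" using \<psi> x by (simp add: Aut_p_iff)
    then have "K #> (\<psi> x \<otimes> inv x) \<in> K_p p (G Mod K)" using \<pi>.K_p_img by blast
    moreover have "K #> (\<psi> x \<otimes> inv x) = (K #> \<psi> x) \<otimes>\<^bsub>G Mod K\<^esub> inv\<^bsub>G Mod K\<^esub> (K #> x)"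
      using x(1) auto_closed[OF a x(1)]
      by (simp only: \<pi>.hom_mult \<pi>.hom_inv group.inv_closed[OF group_axioms])
    ultimately show ?thesis unfolding x(2) induced_auto_coset[OF group_axioms K a x(1)] by simp
  qed
  then show ?thesis using induced_auto_in_auto[OF K a] by (simp add: Q.Aut_p_iff)
qed

text \<open>Inner automorphisms induce inner ones, so the map from \<open>Aut_p p G\<close> to
  \<open>Out_p p (G Mod K)\<close> kills \<open>inn G\<close> and factors through
  \<open>Out_p p G\<close>.\<close>

lemma (in group) induced_hom_Out_p:
  assumes K: "characteristic K G"
  obtains h where "h \<in> hom (Out_p p G) (Out_p p (G Mod K))"
    "\<And>\<psi>. \<psi> \<in> Aut_p p G \<Longrightarrow>
      h (inn G #>\<^bsub>AutoGroup G\<^esub> \<psi>) = inn (G Mod K) #>\<^bsub>AutoGroup (G Mod K)\<^esub> induced_auto G K \<psi>"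
proof -
  let ?Q = "G Mod K"
  let ?A = "\<lambda>G. (AutoGroup G)\<lparr>carrier := Aut_p p G\<rparr>"
  interpret K: normal K G by (rule characteristic_imp_normal[OF K])
  interpret Q: group ?Q by (rule K.factorgroup_is_group)
  interpret \<theta>: group_hom "AutoGroup G" "AutoGroup ?Q" "induced_auto G K"
    by (rule induced_auto_group_hom[OF K])
  interpret I: normal "inn ?Q" "?A ?Q" by (rule Q.inn_normal_Aut_p)
  let ?h = "\<lambda>\<psi>. inn ?Q #>\<^bsub>AutoGroup ?Q\<^esub> induced_auto G K \<psi>"
  have "induced_auto G K \<in> hom (?A G) (?A ?Q)"
    by (rule homI) (use induced_auto_Aut_p[OF K] in \<open>auto simp: Aut_p_iff\<close>)
  then have "?h \<in> hom (?A G) (Out_p p ?Q)"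
    using Group.hom_compose[OF _ I.r_coset_hom_Mod] by (simp add: Out_p_def comp_def)
  then interpret h: group_hom "?A G" "Out_p p ?Q" ?h
    by (simp add: group_hom_def group_hom_axioms_def Aut_p_group Q.Out_p_group)
  have "inn G \<subseteq> kernel (?A G) (Out_p p ?Q) ?h"
  proof
    fix \<psi> assume \<psi>: "\<psi> \<in> inn G"
    then have "induced_auto G K \<psi> \<in> inn ?Q" by (rule induced_auto_inn[OF K])
    then have "?h \<psi> = inn ?Q"
      using group.coset_join2[OF Q.AutoGroup _ normal_imp_subgroup[OF Q.inn_normal]] Q.inn_subset_auto
      by auto
    then show "\<psi> \<in> kernel (?A G) (Out_p p ?Q) ?h"
      using \<psi> inn_subset_Aut_p by (auto simp: kernel_def Out_p_def)
  qed
  then obtain h where "h \<in> hom (?A G Mod inn G) (Out_p p ?Q)"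
    "\<And>\<psi>. \<psi> \<in> carrier (?A G) \<Longrightarrow> h (inn G #>\<^bsub>?A G\<^esub> \<psi>) = ?h \<psi>"
    using h.FactGroup_universal_kernel[OF inn_normal_Aut_p] by metis
  then show thesis using that[of h] by (simp add: Out_p_def)
qed

lemma residually_p_finite_Out_p:
  assumes p: "Factorial_Ring.prime p" and G: "p_IAS p G"
  shows "residually_p_finite p (Out_p p G)"
  unfolding residually_p_finite_def
proof (intro conjI ballI)
  interpret group G using G by (simp add: p_IAS_def)
  show "group (Out_p p G)" by (rule Out_p_group)
  fix c assume c: "c \<in> carrier (Out_p p G) - {\<one>\<^bsub>Out_p p G\<^esub>}"
  then obtain \<phi> where \<phi>: "\<phi> \<in> Aut_p p G" "c = inn G #>\<^bsub>AutoGroup G\<^esub> \<phi>" by (auto simp: carrier_Out_p)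
  have a: "\<phi> \<in> auto G" using \<phi>(1) by (simp add: Aut_p_iff)
  have "c \<noteq> inn G" using c by (simp add: Out_p_def)
  then have "\<phi> \<notin> inn G"
    using group.coset_join2[OF AutoGroup _ normal_imp_subgroup[OF inn_normal]] \<phi>(2) a by auto
  \<comment> \<open>The coset \<open>c\<close> is nontrivial, so its representative is not inner;
    the quotient that detects this also detects \<open>c\<close>.\<close>
  then obtain K where K: "characteristic K G" "finite_p_group p (G Mod K)"
    "induced_auto G K \<phi> \<notin> inn (G Mod K)"
    using G a by (auto simp: p_IAS_def)
  interpret Q: group "G Mod K" using K(2) by (simp add: finite_p_group_def)
  obtain h where h: "h \<in> hom (Out_p p G) (Out_p p (G Mod K))"
    "h c = inn (G Mod K) #>\<^bsub>AutoGroup (G Mod K)\<^esub> induced_auto G K \<phi>"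
    using induced_hom_Out_p[OF K(1)] \<phi> by metis
  interpret h: group_hom "Out_p p G" "Out_p p (G Mod K)" h
    using h(1) by (simp add: group_hom_def group_hom_axioms_def Out_p_group Q.Out_p_group)
  let ?N = "kernel (Out_p p G) (Out_p p (G Mod K)) h"
  have "h c \<noteq> inn (G Mod K)"
    using group.rcos_self[OF Q.AutoGroup _ normal_imp_subgroup[OF Q.inn_normal]] h(2) K(3)
      induced_auto_in_auto[OF K(1) a] by auto
  then have "c \<notin> ?N" by (simp add: kernel_def Out_p_def)
  then show "\<exists>N. N \<lhd> Out_p p G \<and> finite_p_group p (Out_p p G Mod N) \<and> c \<notin> N"
    using finite_p_group_Mod_kernel[OF p Out_p_group finite_p_group_Out_p[OF p K(2)] h(1)]
      h.normal_kernel by blast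
qed

subsection \<open>Finitely generated groups\<close>

text \<open>Induction on the generators: a cyclic group of bounded exponent is finite, and in an
  abelian group the product of two subgroups is again a subgroup, so it contains what they
  generate.\<close>

lemma (in comm_group) finite_generate_bounded_exponent:
  assumes "finite S" "S \<subseteq> carrier G" "n \<noteq> 0" "\<And>x. x \<in> carrier G \<Longrightarrow> x [^] (n::nat) = \<one>"
  shows "finite (generate G S)"
  using assms(1,2)
proof (induction S)
  case (insert s S)
  let ?T = "generate G {s} <#> generate G S"
  have sub: "subgroup (generate G {s}) G" "subgroup (generate G S) G"
    using insert.prems by (auto intro: generate_is_subgroup)
  have "finite (carrier (subgroup_generated G {s}))"
    using finite_cyclic_subgroup[of s] insert.prems assms(3,4) by auto
  then have "finite (generate G {s})"
    using insert.prems by (simp add: carrier_subgroup_generated)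
  then have "finite ?T" using insert by (simp add: set_mult_def)
  moreover have "generate G (insert s S) \<subseteq> ?T"
  proof (rule generate_subgroup_incl[OF _ mult_subgroups[OF sub]])
    have "s \<otimes> \<one> \<in> ?T"
      unfolding set_mult_def using generate.incl[of s "{s}" G] generate.one[of G S] by blast
    moreover have "\<one> \<otimes> x \<in> ?T" if "x \<in> S" for x
      unfolding set_mult_def using generate.incl[OF that, of G] generate.one[of G "{s}"] by blast
    ultimately show "insert s S \<subseteq> ?T" using insert.prems by (auto simp: subset_iff)
  qed
  ultimately show ?case by (rule rev_finite_subset)
qed (simp add: generate_empty)

lemma finite_Mod_K_p:
  assumes "group G" "finitely_generated G" "p \<noteq> 0"
  shows "finite (carrier (G Mod K_p p G))"
proof -
  interpret group G by fact
  let ?K = "K_p p G"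
  let ?Q = "G Mod ?K"
  interpret K: normal ?K G by (rule K_p_normal)
  interpret Q: group ?Q by (rule K.factorgroup_is_group)
  interpret \<pi>: group_hom G ?Q "\<lambda>x. ?K #>\<^bsub>G\<^esub> x"
    using K.r_coset_hom_Mod by unfold_locales
  have K1: "?K #>\<^bsub>G\<^esub> x = \<one>\<^bsub>?Q\<^esub>" if "x \<in> ?K" for x
    using that coset_join2[OF _ K.is_subgroup] K.subset by auto
  have comm: "comm_group ?Q"
  proof (rule Q.group_comm_groupI)
    fix C D assume "C \<in> carrier ?Q" "D \<in> carrier ?Q"
    then obtain x y where xy: "x \<in> carrier G" "y \<in> carrier G" "C = ?K #>\<^bsub>G\<^esub> x" "D = ?K #>\<^bsub>G\<^esub> y"
      by (auto simp: carrier_FactGroup)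
    \<comment> \<open>The commutator of \<open>x\<close> and \<open>y\<close> is split off because
      it becomes trivial modulo \<open>K_p\<close>.\<close>
    have "x \<otimes>\<^bsub>G\<^esub> y = x \<otimes>\<^bsub>G\<^esub> y \<otimes>\<^bsub>G\<^esub> inv\<^bsub>G\<^esub> x \<otimes>\<^bsub>G\<^esub> inv\<^bsub>G\<^esub> y \<otimes>\<^bsub>G\<^esub> (y \<otimes>\<^bsub>G\<^esub> x)"
    proof -
      have "inv\<^bsub>G\<^esub> y \<otimes>\<^bsub>G\<^esub> (y \<otimes>\<^bsub>G\<^esub> x) = x" using xy(1,2) by (simp flip: m_assoc)
      then show ?thesis using xy(1,2) by (simp add: m_assoc)
    qed
    then have "?K #>\<^bsub>G\<^esub> (x \<otimes>\<^bsub>G\<^esub> y) = ?K #>\<^bsub>G\<^esub> (y \<otimes>\<^bsub>G\<^esub> x)"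
      using xy(1,2) K1[OF commutator_in_K_p[OF xy(1,2)]]
        \<pi>.hom_mult[of "x \<otimes>\<^bsub>G\<^esub> y \<otimes>\<^bsub>G\<^esub> inv\<^bsub>G\<^esub> x \<otimes>\<^bsub>G\<^esub> inv\<^bsub>G\<^esub> y" "y \<otimes>\<^bsub>G\<^esub> x"]
        Q.l_one[OF \<pi>.hom_closed[of "y \<otimes>\<^bsub>G\<^esub> x"]] by (metis inv_closed m_closed)
    then show "C \<otimes>\<^bsub>?Q\<^esub> D = D \<otimes>\<^bsub>?Q\<^esub> C"
      unfolding xy(3,4) using \<pi>.hom_mult xy(1,2) by metis
  qed
  have exp: "C [^]\<^bsub>?Q\<^esub> p = \<one>\<^bsub>?Q\<^esub>" if C: "C \<in> carrier ?Q" for C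
  proof -
    obtain x where x: "x \<in> carrier G" "C = ?K #>\<^bsub>G\<^esub> x" using C by (auto simp: carrier_FactGroup)
    then show ?thesis using K.FactGroup_pow[OF x(1)] K1[OF power_in_K_p[OF x(1)]] by simp
  qed
  obtain S where S: "S \<subseteq> carrier G" "finite S" "generate G S = carrier G"
    using assms by (auto simp: finitely_generated_def)
  have "carrier ?Q = generate ?Q ((\<lambda>x. ?K #>\<^bsub>G\<^esub> x) ` S)"
    using \<pi>.generate_img[OF S(1)] S(3) by (simp add: carrier_FactGroup)
  moreover have "finite (generate ?Q ((\<lambda>x. ?K #>\<^bsub>G\<^esub> x) ` S))"
    by (rule comm_group.finite_generate_bounded_exponent[OF comm _ _ assms(3) exp])
      (use S \<pi>.hom_closed in auto)
  ultimately show ?thesis by simp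
qed

text \<open>On \<open>A\<close> the map \<open>g\<close> factors through \<open>f\<close>. This
  bounds cosets of \<open>Out_p\<close> by automorphisms of a finite quotient.\<close>

lemma finite_image_factor:
  assumes "finite (f ` A)" "\<And>x y. \<lbrakk>x \<in> A; y \<in> A; f x = f y\<rbrakk> \<Longrightarrow> g x = g y"
  shows "finite (g ` A)"
proof -
  have "g x = g (inv_into A f (f x))" if "x \<in> A" for x
    using that by (intro assms(2)) (simp_all add: inv_into_into f_inv_into_f)
  then have "g ` A = (\<lambda>z. g (inv_into A f z)) ` f ` A" unfolding image_image by (rule image_cong[OF refl])
  then show ?thesis using assms(1) by simp
qed

lemma finite_auto:
  assumes "finite (carrier G)"
  shows "finite (auto G)"
proof -
  have "auto G \<subseteq> Pi\<^sub>E (carrier G) (\<lambda>_. carrier G)"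
    by (auto simp: auto_def Bij_def PiE_def hom_def)
  then show ?thesis
    by (rule finite_subset) (intro finite_PiE assms)
qed

text \<open>Two automorphisms with the same action modulo \<open>K_p\<close> differ by an element of
  \<open>Aut_p\<close>. So the coset of \<open>Out_p\<close> depends only on the induced
  automorphism of the finite group \<open>G Mod K_p p G\<close>.\<close>

lemma finite_index_Out_p:
  assumes G: "group G" "finitely_generated G" and p: "p \<noteq> 0"
  shows "finite (rcosets\<^bsub>Out G\<^esub> carrier (Out_p p G))"
proof -
  interpret group G by fact
  let ?K = "K_p p G" and ?H = "carrier (Out_p p G)"
  interpret K: normal ?K G by (rule K_p_normal)
  interpret A: group "AutoGroup G" by (rule AutoGroup)
  interpret O: group "Out G" by (rule Out_group)
  interpret \<theta>: group_hom "AutoGroup G" "AutoGroup (G Mod ?K)" "induced_auto G ?K"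
    by (rule induced_auto_group_hom[OF K_p_characteristic])
  have "(\<lambda>\<psi>. inn G #>\<^bsub>AutoGroup G\<^esub> \<psi>) \<in> hom (AutoGroup G) (Out G)"
    using normal.r_coset_hom_Mod[OF inn_normal] by (simp add: Out_def)
  then interpret q: group_hom "AutoGroup G" "Out G" "\<lambda>\<psi>. inn G #>\<^bsub>AutoGroup G\<^esub> \<psi>"
    by (simp add: group_hom_def group_hom_axioms_def AutoGroup Out_group)
  let ?q = "\<lambda>\<psi>. inn G #>\<^bsub>AutoGroup G\<^esub> \<psi>"
  let ?F = "\<lambda>\<psi>. ?H #>\<^bsub>Out G\<^esub> ?q \<psi>"
  have H: "subgroup ?H (Out G)" by (rule Out_p_subgroup)
  have "induced_auto G ?K ` auto G \<subseteq> auto (G Mod ?K)"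
    using induced_auto_in_auto[OF K_p_characteristic] by auto
  then have "finite (induced_auto G ?K ` auto G)"
    using finite_auto[OF finite_Mod_K_p[OF G p]] finite_subset by blast
  then have "finite (?F ` auto G)"
  proof (rule finite_image_factor)
    fix \<psi> \<chi> assume a: "\<psi> \<in> auto G" "\<chi> \<in> auto G" and eq: "induced_auto G ?K \<psi> = induced_auto G ?K \<chi>"
    have A: "\<psi> \<in> carrier (AutoGroup G)" "\<chi> \<in> carrier (AutoGroup G)" using a by simp_all
    let ?d = "\<psi> \<otimes>\<^bsub>AutoGroup G\<^esub> inv\<^bsub>AutoGroup G\<^esub> \<chi>"
    have d: "?d \<in> carrier (AutoGroup G)" using A by (simp del: carrier_AutoGroup)
    have "induced_auto G ?K ?d = \<one>\<^bsub>AutoGroup (G Mod ?K)\<^esub>"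
      using A eq \<theta>.hom_closed[OF A(2)] by (simp del: carrier_AutoGroup)
    then have "?d \<in> Aut_p p G" using d by (simp add: Aut_p_def kernel_def)
    then have "?q ?d \<in> ?H" unfolding carrier_Out_p by (rule imageI)
    then have "?q \<psi> \<otimes>\<^bsub>Out G\<^esub> inv\<^bsub>Out G\<^esub> ?q \<chi> \<in> ?H"
      using A by (simp only: q.hom_mult q.hom_inv A.inv_closed)
    then have "?q \<psi> \<in> ?F \<chi>"
      using subgroup.rcos_module[OF H O.group_axioms q.hom_closed[OF A(2)] q.hom_closed[OF A(1)]] by blast
    then show "?F \<psi> = ?F \<chi>"
      using O.repr_independence[OF _ q.hom_closed[OF A(2)] H] by metis
  qed
  moreover have "rcosets\<^bsub>Out G\<^esub> ?H = ?F ` auto G"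
    by (auto simp: RCOSETS_def Out_def carrier_FactGroup)
  ultimately show ?thesis by simp
qed

lemma virtually_residually_p_finite_Out:
  assumes "Factorial_Ring.prime p" "finitely_generated G" "p_IAS p G"
  shows "virtually_residually_p_finite p (Out G)"
proof -
  interpret group G using assms by (simp add: p_IAS_def)
  have "p \<noteq> 0" using assms(1) by auto
  then have "finite (rcosets\<^bsub>Out G\<^esub> carrier (Out_p p G))"
    by (rule finite_index_Out_p[OF group_axioms assms(2)])
  moreover have "residually_p_finite p ((Out G)\<lparr>carrier := carrier (Out_p p G)\<rparr>)"
    unfolding Out_p_eq[symmetric] by (rule residually_p_finite_Out_p[OF assms(1,3)])
  ultimately show ?thesis
    unfolding virtually_residually_p_finite_def using Out_group Out_p_subgroup by blast
qed

section \<open>Characteristic subgroups inside kernels of maps to finite p-groups\<close>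

lemma hom_eq_on_generate:
  assumes "group_hom G H f" "group_hom G H g" "S \<subseteq> carrier G" "x \<in> generate G S"
    and eq: "\<And>s. s \<in> S \<Longrightarrow> f s = g s"
  shows "f x = g x"
proof -
  interpret f: group_hom G H f by fact
  interpret g: group_hom G H g by fact
  have "subgroup {x \<in> carrier G. f x = g x} G"
    by (rule f.G.subgroupI) (auto intro!: exI[of _ "\<one>\<^bsub>G\<^esub>"])
  then have "generate G S \<subseteq> {x \<in> carrier G. f x = g x}"
    using assms(3) eq by (intro f.G.generate_subgroup_incl) auto
  then show ?thesis using assms(4) by auto
qed

text \<open>A homomorphism is determined by its values on the generators. Extensionality fixes the
  values off the carrier, so that one homomorphism is not counted as many functions.\<close>

lemma finite_hom_on_generators:
  assumes "group G" "S \<subseteq> carrier G" "finite S" "generate G S = carrier G"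
    and "group P" "finite (carrier P)"
  shows "finite {f \<in> hom G P. f \<in> extensional (carrier G)}"
proof -
  let ?F = "{f \<in> hom G P. f \<in> extensional (carrier G)}"
  have "(\<lambda>f. restrict f S) ` ?F \<subseteq> Pi\<^sub>E S (\<lambda>_. carrier P)"
    using assms(2) by (auto simp: hom_def)
  then have "finite ((\<lambda>f. restrict f S) ` ?F)"
    by (rule finite_subset) (intro finite_PiE assms)
  moreover have "inj_on (\<lambda>f. restrict f S) ?F"
  proof (rule inj_onI)
    fix f g assume fg: "f \<in> ?F" "g \<in> ?F" "restrict f S = restrict g S"
    have "f s = g s" if "s \<in> S" for s using fg(3) that by (metis restrict_apply')
    then have "f x = g x" if "x \<in> carrier G" for x
      using hom_eq_on_generate[of G P f g S x] fg assms that
      by (simp add: group_hom_def group_hom_axioms_def)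
    then show "f = g" using fg by (auto intro: extensionalityI)
  qed
  ultimately show ?thesis by (rule finite_imageD)
qed

lemma finite_p_group_DirProd:
  assumes "finite_p_group p G" "finite_p_group p H"
  shows "finite_p_group p (G \<times>\<times> H)"
proof -
  obtain m n where "order G = p ^ m" "order H = p ^ n" using assms by (auto simp: finite_p_group_def)
  then have "order (G \<times>\<times> H) = p ^ (m + n)" by (simp add: order_def card_cartesian_product power_add)
  then show ?thesis using assms by (auto simp: finite_p_group_def DirProd_group)
qed

text \<open>Induction on \<open>F\<close>: if \<open>K\<close> is the common kernel so far, the pair
  of \<open>f\<close> and the projection to \<open>G Mod K\<close> maps \<open>G\<close> into a
  finite p-group, and its kernel is the next common kernel.\<close>

lemma finite_p_group_Mod_common_kernel:
  assumes p: "Factorial_Ring.prime p" and G: "group G" and P: "finite_p_group p P"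
    and F: "finite F" "F \<subseteq> hom G P"
  shows "{x \<in> carrier G. \<forall>f \<in> F. f x = \<one>\<^bsub>P\<^esub>} \<lhd> G \<and>
    finite_p_group p (G Mod {x \<in> carrier G. \<forall>f \<in> F. f x = \<one>\<^bsub>P\<^esub>})"
  using F
proof (induction F)
  case empty
  interpret P: group P using P by (simp add: finite_p_group_def)
  \<comment> \<open>The empty intersection is all of \<open>G\<close>, realized as the kernel of the
    trivial homomorphism.\<close>
  have h: "(\<lambda>_. \<one>\<^bsub>P\<^esub>) \<in> hom G P" by (simp add: hom_def)
  have "kernel G P (\<lambda>_. \<one>\<^bsub>P\<^esub>) = {x \<in> carrier G. \<forall>f \<in> {}. f x = \<one>\<^bsub>P\<^esub>}"
    by (simp add: kernel_def)
  then show ?case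
    using finite_p_group_Mod_kernel[OF p G P h] group_hom.normal_kernel[of G P] G P.group_axioms h
    by (metis group_hom.intro group_hom_axioms.intro)
next
  case (insert f F)
  define K where "K = {x \<in> carrier G. \<forall>f \<in> F. f x = \<one>\<^bsub>P\<^esub>}"
  let ?h = "\<lambda>x. (f x, K #>\<^bsub>G\<^esub> x)"
  have IH: "K \<lhd> G" "finite_p_group p (G Mod K)"
    unfolding K_def using insert.IH insert.prems by blast+
  interpret K: normal K G by (rule IH(1))
  have Q: "finite_p_group p (P \<times>\<times> (G Mod K))"
    by (rule finite_p_group_DirProd[OF P IH(2)])
  have "f \<in> hom G P" using insert.prems by simp
  then have h: "?h \<in> hom G (P \<times>\<times> (G Mod K))"
    using K.r_coset_hom_Mod by (simp only: hom_paired simp_thms)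
  have "K #>\<^bsub>G\<^esub> x = K \<longleftrightarrow> x \<in> K" if "x \<in> carrier G" for x
    using group.coset_join1[OF G _ that K.is_subgroup] group.coset_join2[OF G that K.is_subgroup] by blast
  moreover have "x \<in> K \<longleftrightarrow> x \<in> carrier G \<and> (\<forall>f \<in> F. f x = \<one>\<^bsub>P\<^esub>)" for x
    using K_def by blast
  ultimately have "kernel G (P \<times>\<times> (G Mod K)) ?h = {x \<in> carrier G. \<forall>f \<in> insert f F. f x = \<one>\<^bsub>P\<^esub>}"
    unfolding kernel_def by (auto simp del: K.mem_carrier)
  moreover have "kernel G (P \<times>\<times> (G Mod K)) ?h \<lhd> G"
    using Q G h by (intro group_hom.normal_kernel)
      (simp add: group_hom_def group_hom_axioms_def finite_p_group_def)
  ultimately show ?case using finite_p_group_Mod_kernel[OF p G Q h] by simp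
qed

text \<open>\<open>K\<close> is the intersection of the preimages of the kernel under all automorphisms; only finitely
  many of these preimages are distinct.\<close>

lemma characteristic_subgroup_in_kernel:
  assumes p: "Factorial_Ring.prime p" and G: "group G" "finitely_generated G"
    and P: "finite_p_group p P" and f: "f \<in> hom G P"
  obtains K where "characteristic K G" "finite_p_group p (G Mod K)" "K \<subseteq> kernel G P f"
proof -
  interpret group G by fact
  interpret P: group P using P by (simp add: finite_p_group_def)
  \<comment> \<open>Restricting the composites makes them extensional, so that
    \<open>finite_hom_on_generators\<close> applies.\<close>
  let ?F = "(\<lambda>\<phi>. \<lambda>x \<in> carrier G. f (\<phi> x)) ` auto G"
  let ?K = "{x \<in> carrier G. \<forall>h \<in> ?F. h x = \<one>\<^bsub>P\<^esub>}"
  have K_iff: "x \<in> ?K \<longleftrightarrow> x \<in> carrier G \<and> (\<forall>\<phi> \<in> auto G. f (\<phi> x) = \<one>\<^bsub>P\<^esub>)" for x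
    by auto
  obtain S where S: "S \<subseteq> carrier G" "finite S" "generate G S = carrier G"
    using G(2) by (auto simp: finitely_generated_def)
  have F: "?F \<subseteq> {h \<in> hom G P. h \<in> extensional (carrier G)}"
    using f by (auto simp: auto_def hom_def Pi_iff)
  then have "finite ?F"
    using finite_hom_on_generators[OF G(1) S P.group_axioms] P finite_subset
    by (auto simp: finite_p_group_def)
  moreover have "?F \<subseteq> hom G P" using F by blast
  ultimately have K: "?K \<lhd> G" "finite_p_group p (G Mod ?K)"
    using finite_p_group_Mod_common_kernel[OF p G(1) P, of ?F] by blast+
  have "characteristic ?K G"
  proof (rule characteristicI[OF normal_imp_subgroup[OF K(1)]])
    fix \<psi> x assume \<psi>: "\<psi> \<in> auto G" and x: "x \<in> ?K"
    have xG: "x \<in> carrier G" using x by simp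
    interpret A: group "AutoGroup G" by (rule AutoGroup)
    have "f (\<phi> (\<psi> x)) = \<one>\<^bsub>P\<^esub>" if \<phi>: "\<phi> \<in> auto G" for \<phi>
    proof -
      have "compose (carrier G) \<phi> \<psi> \<in> auto G"
        using A.m_closed[of \<phi> \<psi>] \<phi> \<psi> by (simp add: mult_AutoGroup)
      then have "f (compose (carrier G) \<phi> \<psi> x) = \<one>\<^bsub>P\<^esub>" using x K_iff by blast
      then show ?thesis using xG by (simp add: compose_eq)
    qed
    then show "\<psi> x \<in> ?K" using auto_closed[OF \<psi> xG] unfolding K_iff by blast
  qed
  moreover have "?K \<subseteq> kernel G P f"
  proof
    fix x assume "x \<in> ?K"
    then have "x \<in> carrier G" "f ((\<lambda>x \<in> carrier G. x) x) = \<one>\<^bsub>P\<^esub>"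
      using id_in_auto unfolding K_iff by blast+
    then show "x \<in> kernel G P f" by (simp add: kernel_def)
  qed
  ultimately show thesis using that K(2) by blast
qed

lemma finitely_generated_DirProd:
  assumes "group G" "group H" "finitely_generated G" "finitely_generated H"
  shows "finitely_generated (G \<times>\<times> H)"
proof -
  interpret G: group G by fact
  interpret H: group H by fact
  interpret D: group "G \<times>\<times> H" using assms by (simp add: DirProd_group)
  let ?i = "\<lambda>x. (x, \<one>\<^bsub>H\<^esub>)" and ?j = "\<lambda>y. (\<one>\<^bsub>G\<^esub>, y)"
  interpret i: group_hom G "G \<times>\<times> H" ?i by unfold_locales (simp add: hom_def Pi_iff)
  interpret j: group_hom H "G \<times>\<times> H" ?j by unfold_locales (simp add: hom_def Pi_iff)
  obtain S T where S: "S \<subseteq> carrier G" "finite S" "generate G S = carrier G"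
    and T: "T \<subseteq> carrier H" "finite T" "generate H T = carrier H"
    using assms by (auto simp: finitely_generated_def)
  let ?U = "?i ` S \<union> ?j ` T"
  have U: "?U \<subseteq> carrier (G \<times>\<times> H)" using S T by auto
  have gen: "subgroup (generate (G \<times>\<times> H) ?U) (G \<times>\<times> H)" by (rule D.generate_is_subgroup[OF U])
  have "carrier (G \<times>\<times> H) \<subseteq> generate (G \<times>\<times> H) ?U"
  proof
    fix z assume "z \<in> carrier (G \<times>\<times> H)"
    then obtain x y where xy: "x \<in> carrier G" "y \<in> carrier H" "z = ?i x \<otimes>\<^bsub>G \<times>\<times> H\<^esub> ?j y" by auto
    have "?i x \<in> generate (G \<times>\<times> H) ?U" "?j y \<in> generate (G \<times>\<times> H) ?U"
      using xy(1,2) S(3) T(3) i.generate_img[OF S(1)] j.generate_img[OF T(1)]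
        D.mono_generate[of "?i ` S" ?U] D.mono_generate[of "?j ` T" ?U] by blast+
    then show "z \<in> generate (G \<times>\<times> H) ?U" unfolding xy(3) by (rule subgroup.m_closed[OF gen])
  qed
  then have "generate (G \<times>\<times> H) ?U = carrier (G \<times>\<times> H)" using subgroup.subset[OF gen] by blast
  then show ?thesis using U S(2) T(2) unfolding finitely_generated_def by (metis finite_UnI finite_imageI)
qed

subsection \<open>Automorphisms that are inner in every finite \<open>p\<close>-quotient\<close>

text \<open>The failure of the separation condition of \<open>p_IAS\<close> at the single map
  \<open>\<phi>\<close>: a group is \<open>p\<close>-IAS when every automorphism with this property
  is inner.\<close>

definition inner_in_p_quotients :: "nat \<Rightarrow> ('a, 'b) monoid_scheme \<Rightarrow> ('a \<Rightarrow> 'a) \<Rightarrow> bool" where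
  "inner_in_p_quotients p G \<phi> \<longleftrightarrow>
     (\<forall>K. characteristic K G \<longrightarrow> finite_p_group p (G Mod K) \<longrightarrow> induced_auto G K \<phi> \<in> inn (G Mod K))"

text \<open>A characteristic \<open>K\<close> inside the kernel lets \<open>f\<close> factor through
  \<open>G Mod K\<close>, where \<open>\<phi>\<close> is conjugation by a coset; any representative
  serves as \<open>g\<close>. The kernel of \<open>f\<close> itself need not be characteristic, so
  \<open>f\<close> may be a projection onto a quotient of a direct factor.\<close>

lemma inner_in_p_quotients_hom:
  assumes p: "Factorial_Ring.prime p" and G: "group G" "finitely_generated G"
    and \<phi>: "\<phi> \<in> auto G" "inner_in_p_quotients p G \<phi>"
    and P: "finite_p_group p P" and f: "f \<in> hom G P"
  obtains g where "g \<in> carrier G"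
    "\<And>x. x \<in> carrier G \<Longrightarrow> f (\<phi> x) = f (g \<otimes>\<^bsub>G\<^esub> x \<otimes>\<^bsub>G\<^esub> inv\<^bsub>G\<^esub> g)"
proof -
  interpret group G by fact
  interpret f: group_hom G P f
    using G P f by (simp add: group_hom_def group_hom_axioms_def finite_p_group_def)
  obtain K where K: "characteristic K G" "finite_p_group p (G Mod K)" "K \<subseteq> kernel G P f"
    using characteristic_subgroup_in_kernel[OF p G P f] by blast
  interpret K: normal K G by (rule characteristic_imp_normal[OF K(1)])
  interpret Q: group "G Mod K" by (rule K.factorgroup_is_group)
  interpret \<pi>: group_hom G "G Mod K" "\<lambda>x. K #>\<^bsub>G\<^esub> x"
    using K.r_coset_hom_Mod by unfold_locales
  have "induced_auto G K \<phi> \<in> inn (G Mod K)" using \<phi>(2) K by (simp add: inner_in_p_quotients_def)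
  then obtain g where g: "g \<in> carrier G"
    "\<And>C. C \<in> carrier (G Mod K) \<Longrightarrow> induced_auto G K \<phi> C
      = (K #>\<^bsub>G\<^esub> g) \<otimes>\<^bsub>G Mod K\<^esub> C \<otimes>\<^bsub>G Mod K\<^esub> inv\<^bsub>G Mod K\<^esub> (K #>\<^bsub>G\<^esub> g)"
    by (elim innE) (auto simp: carrier_FactGroup)
  have "f (\<phi> x) = f (g \<otimes>\<^bsub>G\<^esub> x \<otimes>\<^bsub>G\<^esub> inv\<^bsub>G\<^esub> g)" if x: "x \<in> carrier G" for x
  proof -
    let ?y = "g \<otimes>\<^bsub>G\<^esub> x \<otimes>\<^bsub>G\<^esub> inv\<^bsub>G\<^esub> g"
    have y: "?y \<in> carrier G" using g x by simp
    have "K #>\<^bsub>G\<^esub> \<phi> x = K #>\<^bsub>G\<^esub> ?y"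
      using g(2)[OF \<pi>.hom_closed[OF x]] induced_auto_coset[OF G(1) K(1) \<phi>(1) x] g(1) x
      by (simp only: \<pi>.hom_mult \<pi>.hom_inv m_closed inv_closed)
    then have "\<phi> x \<in> K #>\<^bsub>G\<^esub> ?y" using rcos_self[OF auto_closed[OF \<phi>(1) x] K.is_subgroup] by simp
    then obtain k where "k \<in> K" "\<phi> x = k \<otimes>\<^bsub>G\<^esub> ?y" by (auto simp: r_coset_def)
    then show ?thesis using K(3) y by (auto simp: kernel_def)
  qed
  then show thesis using that g(1) by blast
qed

text \<open>In every finite p-quotient of \<open>B\<close> the image of
  \<open>\<sigma> (\<phi> x)\<close> is a conjugate of the image of \<open>\<sigma> x\<close>, hence
  trivial. With \<open>\<sigma>\<close> a projection of a direct product, this says that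
  \<open>\<phi>\<close> maps the complementary factor into itself.\<close>

lemma inner_in_p_quotients_fixes_kernel:
  assumes p: "Factorial_Ring.prime p" and G: "group G" "finitely_generated G"
    and \<phi>: "\<phi> \<in> auto G" "inner_in_p_quotients p G \<phi>"
    and B: "residually_p_finite p B" and \<sigma>: "\<sigma> \<in> hom G B"
    and x: "x \<in> carrier G" "\<sigma> x = \<one>\<^bsub>B\<^esub>"
  shows "\<sigma> (\<phi> x) = \<one>\<^bsub>B\<^esub>"
proof (rule ccontr)
  assume ne: "\<sigma> (\<phi> x) \<noteq> \<one>\<^bsub>B\<^esub>"
  interpret G: group G by fact
  interpret B: group B using B by (simp add: residually_p_finite_def)
  interpret \<sigma>: group_hom G B \<sigma> using \<sigma> by unfold_locales
  have c: "\<sigma> (\<phi> x) \<in> carrier B" using auto_closed[OF \<phi>(1) x(1)] by simp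
  then obtain N where N: "N \<lhd> B" "finite_p_group p (B Mod N)" "\<sigma> (\<phi> x) \<notin> N"
    using B ne by (auto simp: residually_p_finite_def)
  interpret N: normal N B by fact
  have f: "(\<lambda>x. N #>\<^bsub>B\<^esub> \<sigma> x) \<in> hom G (B Mod N)"
    using Group.hom_compose[OF \<sigma> N.r_coset_hom_Mod] by (simp add: comp_def)
  obtain g where "g \<in> carrier G" "N #>\<^bsub>B\<^esub> \<sigma> (\<phi> x) = N #>\<^bsub>B\<^esub> \<sigma> (g \<otimes>\<^bsub>G\<^esub> x \<otimes>\<^bsub>G\<^esub> inv\<^bsub>G\<^esub> g)"
    using inner_in_p_quotients_hom[OF p G \<phi> N(2) f] x(1) by metis
  then have "N #>\<^bsub>B\<^esub> \<sigma> (\<phi> x) = N" using x N.subset by simp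
  then show False using N(3) B.coset_join1[OF _ c N.is_subgroup] by blast
qed

text \<open>Treats both factors at once, with \<open>\<iota>\<close> the inclusion and
  \<open>\<rho>\<close> the projection. By \<open>range\<close>, \<open>\<phi>\<close> preserves the
  image of \<open>\<iota>\<close>; by \<open>factor\<close>, \<open>\<rho> (\<phi> x)\<close>
  depends only on \<open>\<rho> x\<close>. So \<open>\<phi>\<close> restricts to an automorphism of
  \<open>A\<close>, and in each characteristic finite p-quotient of \<open>A\<close> this is
  conjugation by some \<open>\<rho> g\<close>.\<close>

lemma inner_in_p_quotients_retract:
  assumes p: "Factorial_Ring.prime p" and G: "group G" "finitely_generated G"
    and \<phi>: "\<phi> \<in> auto G" "inner_in_p_quotients p G \<phi>"
    and A: "p_IAS p A" and \<iota>: "\<iota> \<in> hom A G" and \<rho>: "\<rho> \<in> hom G A"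
    and retract: "\<And>a. a \<in> carrier A \<Longrightarrow> \<rho> (\<iota> a) = a"
    and range: "\<And>a. a \<in> carrier A \<Longrightarrow> \<iota> (\<rho> (\<phi> (\<iota> a))) = \<phi> (\<iota> a)"
    and factor: "\<And>x. x \<in> carrier G \<Longrightarrow> \<rho> (\<phi> (\<iota> (\<rho> x))) = \<rho> (\<phi> x)"
  obtains c where "c \<in> carrier A"
    "\<And>a. a \<in> carrier A \<Longrightarrow> \<rho> (\<phi> (\<iota> a)) = c \<otimes>\<^bsub>A\<^esub> a \<otimes>\<^bsub>A\<^esub> inv\<^bsub>A\<^esub> c"
proof -
  interpret G: group G by fact
  interpret A: group A using A by (simp add: p_IAS_def)
  interpret \<iota>: group_hom A G \<iota> using \<iota> by unfold_locales
  interpret \<rho>: group_hom G A \<rho> using \<rho> by unfold_locales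
  interpret \<phi>: group_hom G G \<phi> by (rule G.auto_group_hom[OF \<phi>(1)])
  let ?\<alpha> = "\<lambda>a \<in> carrier A. \<rho> (\<phi> (\<iota> a))"
  have \<alpha>: "?\<alpha> \<in> auto A"
  proof (rule A.autoI)
    show "?\<alpha> \<in> hom A A" by (rule homI) simp_all
    show "inj_on ?\<alpha> (carrier A)"
    proof (rule inj_onI)
      fix a b assume ab: "a \<in> carrier A" "b \<in> carrier A" "?\<alpha> a = ?\<alpha> b"
      then have "\<phi> (\<iota> a) = \<phi> (\<iota> b)" using range by (metis restrict_apply')
      then have "\<iota> a = \<iota> b" using auto_inj_on[OF \<phi>(1)] ab by (simp add: inj_on_eq_iff)
      then show "a = b" using retract ab by metis
    qed
    show "carrier A \<subseteq> ?\<alpha> ` carrier A"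
    proof
      fix a assume a: "a \<in> carrier A"
      \<comment> \<open>The preimage \<open>x\<close> is not known to lie in the image of
        \<open>\<iota>\<close>; \<open>factor\<close> allows \<open>\<iota> (\<rho> x)\<close> to
        take its place.\<close>
      then obtain x where x: "x \<in> carrier G" "\<iota> a = \<phi> x"
        using auto_image[OF \<phi>(1)] \<iota>.hom_closed by (metis imageE)
      then have "a = ?\<alpha> (\<rho> x)" using retract[OF a] factor[OF x(1)] by simp
      then show "a \<in> ?\<alpha> ` carrier A" by (rule image_eqI) (use x in simp)
    qed
  qed simp
  have "?\<alpha> \<in> inn A"
  proof (rule ccontr)
    assume "?\<alpha> \<notin> inn A"
    then obtain K where K: "characteristic K A" "finite_p_group p (A Mod K)"
      "induced_auto A K ?\<alpha> \<notin> inn (A Mod K)"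
      using A \<alpha> by (auto simp: p_IAS_def)
    interpret K: normal K A by (rule A.characteristic_imp_normal[OF K(1)])
    interpret Q: group "A Mod K" by (rule K.factorgroup_is_group)
    interpret \<pi>: group_hom A "A Mod K" "\<lambda>x. K #>\<^bsub>A\<^esub> x"
      using K.r_coset_hom_Mod by unfold_locales
    have f: "(\<lambda>x. K #>\<^bsub>A\<^esub> \<rho> x) \<in> hom G (A Mod K)"
      using Group.hom_compose[OF \<rho> K.r_coset_hom_Mod] by (simp add: comp_def)
    obtain g where g: "g \<in> carrier G"
      "\<And>x. x \<in> carrier G \<Longrightarrow> K #>\<^bsub>A\<^esub> \<rho> (\<phi> x) = K #>\<^bsub>A\<^esub> \<rho> (g \<otimes>\<^bsub>G\<^esub> x \<otimes>\<^bsub>G\<^esub> inv\<^bsub>G\<^esub> g)"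
      using inner_in_p_quotients_hom[OF p G \<phi> K(2) f] by metis
    have "induced_auto A K ?\<alpha> \<in> inn (A Mod K)"
    proof (rule Q.innI[OF A.induced_auto_in_auto[OF K(1) \<alpha>] \<pi>.hom_closed[OF \<rho>.hom_closed[OF g(1)]]])
      fix C assume "C \<in> carrier (A Mod K)"
      then obtain a where a: "a \<in> carrier A" "C = K #>\<^bsub>A\<^esub> a" by (auto simp: carrier_FactGroup)
      have "induced_auto A K ?\<alpha> C = K #>\<^bsub>A\<^esub> \<rho> (\<phi> (\<iota> a))"
        using induced_auto_coset[OF A.group_axioms K(1) \<alpha> a(1)] a by simp
      also have "\<dots> = K #>\<^bsub>A\<^esub> (\<rho> g \<otimes>\<^bsub>A\<^esub> a \<otimes>\<^bsub>A\<^esub> inv\<^bsub>A\<^esub> \<rho> g)"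
        using g a by (simp add: retract)
      also have "\<dots> = (K #>\<^bsub>A\<^esub> \<rho> g) \<otimes>\<^bsub>A Mod K\<^esub> C \<otimes>\<^bsub>A Mod K\<^esub> inv\<^bsub>A Mod K\<^esub> (K #>\<^bsub>A\<^esub> \<rho> g)"
        unfolding a(2) using a(1) \<rho>.hom_closed[OF g(1)]
        by (simp only: \<pi>.hom_mult \<pi>.hom_inv A.m_closed A.inv_closed)
      finally show "induced_auto A K ?\<alpha> C
          = (K #>\<^bsub>A\<^esub> \<rho> g) \<otimes>\<^bsub>A Mod K\<^esub> C \<otimes>\<^bsub>A Mod K\<^esub> inv\<^bsub>A Mod K\<^esub> (K #>\<^bsub>A\<^esub> \<rho> g)" .
    qed
    then show False using K(3) by simp
  qed
  then show thesis using that by (elim innE) simp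
qed

section \<open>Direct products of \<open>p\<close>-IAS groups\<close>

lemma p_IAS_DirProd:
  assumes p: "Factorial_Ring.prime p"
    and A: "finitely_generated A" "residually_p_finite p A" "p_IAS p A"
    and B: "finitely_generated B" "residually_p_finite p B" "p_IAS p B"
  shows "p_IAS p (A \<times>\<times> B)"
proof -
  interpret A: group A using A by (simp add: p_IAS_def)
  interpret B: group B using B by (simp add: p_IAS_def)
  let ?G = "A \<times>\<times> B"
  interpret G: group ?G by (simp add: DirProd_group)
  let ?i = "\<lambda>a. (a, \<one>\<^bsub>B\<^esub>)" and ?j = "\<lambda>b. (\<one>\<^bsub>A\<^esub>, b)"
  have hom: "?i \<in> hom A ?G" "?j \<in> hom B ?G" "fst \<in> hom ?G A" "snd \<in> hom ?G B"
    by (auto simp: hom_def Pi_iff)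
  note fg = finitely_generated_DirProd[OF A.group_axioms B.group_axioms A(1) B(1)]
  have "\<phi> \<in> inn ?G" if \<phi>: "\<phi> \<in> auto ?G" "inner_in_p_quotients p ?G \<phi>" for \<phi>
  proof -
    interpret \<phi>: group_hom ?G ?G \<phi> by (rule G.auto_group_hom[OF \<phi>(1)])
    note fixes_kernel = inner_in_p_quotients_fixes_kernel[OF p G.group_axioms fg \<phi>]
    \<comment> \<open>Each factor is the kernel of the projection to the other one.\<close>
    have i: "snd (\<phi> (?i a)) = \<one>\<^bsub>B\<^esub>" if "a \<in> carrier A" for a
      using fixes_kernel[OF B(2) hom(4), of "?i a"] that by simp
    have j: "fst (\<phi> (?j b)) = \<one>\<^bsub>A\<^esub>" if "b \<in> carrier B" for b
      using fixes_kernel[OF A(2) hom(3), of "?j b"] that by simp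
    have cl: "fst (\<phi> x) \<in> carrier A" "snd (\<phi> x) \<in> carrier B" if "x \<in> carrier ?G" for x
      using \<phi>.hom_closed[OF that] by (auto simp: mem_Times_iff)
    \<comment> \<open>The mixed coordinates are trivial by \<open>i\<close> and \<open>j\<close>, so
      \<open>\<phi>\<close> is a product of two maps.\<close>
    have split: "\<phi> (a, b) = (fst (\<phi> (?i a)), snd (\<phi> (?j b)))"
      if ab: "a \<in> carrier A" "b \<in> carrier B" for a b
    proof -
      have "\<phi> (a, b) = \<phi> (?i a) \<otimes>\<^bsub>?G\<^esub> \<phi> (?j b)"
        using \<phi>.hom_mult[of "?i a" "?j b"] ab by simp
      also have "\<dots> = (fst (\<phi> (?i a)), snd (\<phi> (?j b)))"
        using ab cl[of "?i a"] cl[of "?j b"] by (simp add: mult_DirProd' i j)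
      finally show ?thesis .
    qed
    have range: "(fst (\<phi> (?i a)), \<one>\<^bsub>B\<^esub>) = \<phi> (?i a)" "(\<one>\<^bsub>A\<^esub>, snd (\<phi> (?j b))) = \<phi> (?j b)"
      if "a \<in> carrier A" "b \<in> carrier B" for a b
      using i j that by (simp_all add: prod_eq_iff)
    have factor: "fst (\<phi> (?i (fst x))) = fst (\<phi> x)" "snd (\<phi> (?j (snd x))) = snd (\<phi> x)"
      if "x \<in> carrier ?G" for x
      using split[of "fst x" "snd x"] that by (auto simp: mem_Times_iff)
    obtain c where c: "c \<in> carrier A"
      "\<And>a. a \<in> carrier A \<Longrightarrow> fst (\<phi> (?i a)) = c \<otimes>\<^bsub>A\<^esub> a \<otimes>\<^bsub>A\<^esub> inv\<^bsub>A\<^esub> c"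
      by (rule inner_in_p_quotients_retract[OF p G.group_axioms fg \<phi> A(3) hom(1,3)])
        (use range(1)[OF _ B.one_closed] factor(1) in simp_all)
    obtain d where d: "d \<in> carrier B"
      "\<And>b. b \<in> carrier B \<Longrightarrow> snd (\<phi> (?j b)) = d \<otimes>\<^bsub>B\<^esub> b \<otimes>\<^bsub>B\<^esub> inv\<^bsub>B\<^esub> d"
      by (rule inner_in_p_quotients_retract[OF p G.group_axioms fg \<phi> B(3) hom(2,4)])
        (use range(2)[OF A.one_closed] factor(2) in simp_all)
    show ?thesis
    proof (rule G.innI[OF \<phi>(1)])
      show "(c, d) \<in> carrier ?G" using c(1) d(1) by simp
      fix x assume "x \<in> carrier ?G"
      then obtain a b where ab: "a \<in> carrier A" "b \<in> carrier B" "x = (a, b)" by auto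
      show "\<phi> x = (c, d) \<otimes>\<^bsub>?G\<^esub> x \<otimes>\<^bsub>?G\<^esub> inv\<^bsub>?G\<^esub> (c, d)"
        unfolding ab(3) split[OF ab(1,2)] c(2)[OF ab(1)] d(2)[OF ab(2)]
        using ab c(1) d(1) by simp
    qed
  qed
  \<comment> \<open>This is the \<open>p\<close>-IAS property in contrapositive form.\<close>
  then show ?thesis
    by (auto simp: p_IAS_def inner_in_p_quotients_def)
qed

theorem lemma7p3:
  fixes A :: "('a, 'c) monoid_scheme" and B :: "('b, 'd) monoid_scheme" and p :: nat
  assumes "Factorial_Ring.prime p"
    and "group A" and "finitely_generated A" and "residually_p_finite p A" and "p_IAS p A"
    and "group B" and "finitely_generated B" and "residually_p_finite p B" and "p_IAS p B"
  shows "p_IAS p (A \<times>\<times> B) \<and>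
    residually_p_finite p (Out_p p (A \<times>\<times> B)) \<and>
    virtually_residually_p_finite p (Out (A \<times>\<times> B))"
proof -
  have "p_IAS p (A \<times>\<times> B)"
    using p_IAS_DirProd assms by blast
  then show ?thesis
    using residually_p_finite_Out_p virtually_residually_p_finite_Out finitely_generated_DirProd assms
    by blast
qed

end
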